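(* For every integer $n\ge 2$, the generalized $3$-connectivity of the $n$-dimensional folded hypercube $FQ_n$ satisfies $\kappa_3(FQ_n)=n$.
   Context: All graphs are finite, simple and undirected. The $n$-dimensional hypercube $Q_n$ is the graph whose vertices are the binary strings $x_1x_2\cdots x_n$ with $x_i\in\{0,1\}$, two vertices being adjacent if and only if they differ in exactly one digit. The $n$-dimensional folded hypercube $FQ_n$ is the graph obtained from $Q_n$ by adding an edge between $x_1x_2\cdots x_n$ and $\overline{x_1}\,\overline{x_2}\cdots\overline{x_n}$ for every vertex $x_1x_2\cdots x_n$, where $\overline{x_i}=1-x_i$. Let $G=(V(G),E(G))$ be a connected graph and let $k$ be an integer with $2\le k\le |V(G)|$. For a set $S$ of $k$ vertices of $G$, an $S$-tree is a tree $T$ that is a subgraph of $G$ with $S\subseteq V(T)$. A collection $\{T_1,\dots,T_r\}$ of $S$-trees in $G$ is called internally disjoint if $E(T_i)\cap E(T_j)=\emptyset$ and $V(T_i)\cap V(T_j)=S$ for all $1\le i\ne j\le r$. Let $\kappa_G(S)$ denote the maximum number of internally disjoint $S$-trees in $G$. The generalized $k$-connectivity of $G$ is $\kappa_k(G)=\min\{\kappa_G(S): S\subseteq V(G),\ |S|=k\}$. *)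

theory Defs
  imports "Graph_Theory.Graph_Theory"
begin

text \<open>
  As in Graph_Theory, a finite simple undirected graph is a finite symmetric loop-free digraph
  without parallel arcs (\<^const>\<open>graph\<close>): an edge \<open>uv\<close> is the pair of arcs \<open>(u, v)\<close>, \<open>(v, u)\<close>, so for
  such graphs arc-disjoint and edge-disjoint mean the same.

  The constant \<^const>\<open>tree\<close> of the library is not the undirected notion: \<^const>\<open>pre_digraph.cycle\<close>
  counts \<open>u, v, u\<close> as a cycle, so no symmetric digraph with an arc satisfies \<^const>\<open>forest\<close>.  The
  cycles of an undirected graph are those of length at least 3.
\<close>

definition undirected_tree :: "('a, 'b) pre_digraph \<Rightarrow> bool" where
  "undirected_tree T \<longleftrightarrow>
     graph T \<and> connected T \<and> \<not> (\<exists>p. pre_digraph.cycle T p \<and> 3 \<le> length p)"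

definition S_tree :: "'a pair_pre_digraph \<Rightarrow> 'a set \<Rightarrow> 'a pair_pre_digraph \<Rightarrow> bool" where
  "S_tree G S T \<longleftrightarrow>
     subgraph (with_proj T) (with_proj G) \<and> undirected_tree (with_proj T) \<and> S \<subseteq> pverts T"

text \<open>
  For \<open>2 \<le> card S\<close> every \<open>S\<close>-tree has an edge, so the trees of an edge-disjoint family are
  distinct and nothing is lost by taking collections to be sets.
\<close>

definition internally_disjoint_S_trees ::
    "'a pair_pre_digraph \<Rightarrow> 'a set \<Rightarrow> 'a pair_pre_digraph set \<Rightarrow> bool" where
  "internally_disjoint_S_trees G S \<T> \<longleftrightarrow>
     (\<forall>T\<in>\<T>. S_tree G S T) \<and>
     (\<forall>T\<in>\<T>. \<forall>T'\<in>\<T>. T \<noteq> T' \<longrightarrow> parcs T \<inter> parcs T' = {} \<and> pverts T \<inter> pverts T' = S)"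

definition kappa_set :: "'a pair_pre_digraph \<Rightarrow> 'a set \<Rightarrow> nat" where
  "kappa_set G S = Max {card \<T> |\<T>. internally_disjoint_S_trees G S \<T>}"

text \<open>
  Meaningful for a connected graph \<open>G\<close> and \<open>2 \<le> k \<le> card (pverts G)\<close>.
\<close>

definition generalized_connectivity :: "nat \<Rightarrow> 'a pair_pre_digraph \<Rightarrow> nat" where
  "generalized_connectivity k G = Min {kappa_set G S |S. S \<subseteq> pverts G \<and> card S = k}"

definition hypercube :: "nat \<Rightarrow> bool list pair_pre_digraph" where
  "hypercube n =
     \<lparr> pverts = {x. length x = n},
       parcs = {(x, y). length x = n \<and> length y = n \<and> card {i. i < n \<and> x ! i \<noteq> y ! i} = 1} \<rparr>"

definition folded_hypercube :: "nat \<Rightarrow> bool list pair_pre_digraph" where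
  "folded_hypercube n =
     \<lparr> pverts = pverts (hypercube n),
       parcs = parcs (hypercube n) \<union> {(x, map Not x) |x. x \<in> pverts (hypercube n)} \<rparr>"

text \<open>
  The maximum and the minimum above are taken over finite nonempty sets, and the folded hypercube
  satisfies the standing assumptions on \<open>G\<close>.
\<close>

lemma finite_internally_disjoint_S_trees:
  assumes "finite (pverts G)"
  shows "finite {\<T>. internally_disjoint_S_trees G S \<T>}"
proof -
  let ?P = "(\<lambda>(V, A). \<lparr> pverts = V, parcs = A \<rparr>) ` (Pow (pverts G) \<times> Pow (pverts G \<times> pverts G))"
  have "T \<in> ?P" if "S_tree G S T" for T
  proof (rule image_eqI)
    show "T = (case (pverts T, parcs T) of (V, A) \<Rightarrow> \<lparr> pverts = V, parcs = A \<rparr>)"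
      by simp
    have "pverts T \<subseteq> pverts G" and "wf_digraph (with_proj T)"
      using that by (auto simp: S_tree_def subgraph_def)
    then show "(pverts T, parcs T) \<in> Pow (pverts G) \<times> Pow (pverts G \<times> pverts G)"
      by (fastforce simp: wf_digraph_def)
  qed
  then have "{\<T>. internally_disjoint_S_trees G S \<T>} \<subseteq> Pow ?P"
    by (auto simp: internally_disjoint_S_trees_def)
  then show ?thesis
    by (rule finite_subset) (use assms in auto)
qed

lemma kappa_set_finite_nonempty:
  assumes "finite (pverts G)"
  shows "finite {card \<T> |\<T>. internally_disjoint_S_trees G S \<T>}"
    and "{card \<T> |\<T>. internally_disjoint_S_trees G S \<T>} \<noteq> {}"
proof -
  show "finite {card \<T> |\<T>. internally_disjoint_S_trees G S \<T>}"
    using finite_imageI[OF finite_internally_disjoint_S_trees[OF assms], of card]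
    by (simp add: setcompr_eq_image)
  have "internally_disjoint_S_trees G S {}"
    by (simp add: internally_disjoint_S_trees_def)
  then show "{card \<T> |\<T>. internally_disjoint_S_trees G S \<T>} \<noteq> {}"
    by blast
qed

lemma generalized_connectivity_finite_nonempty:
  assumes "finite (pverts G)" and "k \<le> card (pverts G)"
  shows "finite {kappa_set G S |S. S \<subseteq> pverts G \<and> card S = k}"
    and "{kappa_set G S |S. S \<subseteq> pverts G \<and> card S = k} \<noteq> {}"
proof -
  show "finite {kappa_set G S |S. S \<subseteq> pverts G \<and> card S = k}"
    using assms(1) by simp
  obtain S where "S \<subseteq> pverts G" "card S = k"
    using obtain_subset_with_card_n[OF assms(2)] by metis
  then show "{kappa_set G S |S. S \<subseteq> pverts G \<and> card S = k} \<noteq> {}"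
    by blast
qed

lemma card_pverts_folded_hypercube:
  "finite (pverts (folded_hypercube n))" "card (pverts (folded_hypercube n)) = 2 ^ n"
  using finite_lists_length_eq[of "UNIV :: bool set" n] card_lists_length_eq[of "UNIV :: bool set" n]
  by (simp_all add: folded_hypercube_def hypercube_def)

lemma pair_graph_folded_hypercube:
  assumes "1 \<le> n"
  shows "pair_graph (folded_hypercube n)"
proof
  let ?G = "folded_hypercube n"
  show wf: "fst e \<in> pverts ?G" "snd e \<in> pverts ?G" if "e \<in> parcs ?G" for e
    using that by (auto simp: folded_hypercube_def hypercube_def)
  show fin: "finite (pverts ?G)"
    by (rule card_pverts_folded_hypercube)
  have "parcs ?G \<subseteq> pverts ?G \<times> pverts ?G"
    using wf by force
  then show "finite (parcs ?G)"
    using fin finite_subset by blast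
  show "fst e \<noteq> snd e" if "e \<in> parcs ?G" for e
  proof -
    obtain x y where e: "e = (x, y)"
      by (cases e)
    have "x \<noteq> map Not x" if "length x = n"
      using that assms by (cases x) auto
    moreover have "length x = n \<and> y = map Not x \<or> card {i. i < n \<and> x ! i \<noteq> y ! i} = 1"
      using \<open>e \<in> parcs ?G\<close> e by (auto simp: folded_hypercube_def hypercube_def)
    ultimately have "x \<noteq> y"
      by fastforce
    with e show ?thesis
      by simp
  qed
  have "(y, x) \<in> parcs ?G" if xy: "(x, y) \<in> parcs ?G" for x y
  proof -
    have "(x, y) \<in> parcs (hypercube n) \<or> length x = n \<and> y = map Not x"
      using xy by (auto simp: folded_hypercube_def hypercube_def)
    then show ?thesis
    proof
      assume "(x, y) \<in> parcs (hypercube n)"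
      moreover have "{i. i < n \<and> y ! i \<noteq> x ! i} = {i. i < n \<and> x ! i \<noteq> y ! i}"
        by blast
      ultimately show ?thesis
        by (simp add: folded_hypercube_def hypercube_def)
    next
      assume "length x = n \<and> y = map Not x"
      then have "length y = n \<and> x = map Not y"
        by (simp add: list_eq_iff_nth_eq)
      then show ?thesis
        by (simp add: folded_hypercube_def hypercube_def)
    qed
  qed
  then show "symmetric (with_proj ?G)"
    by (simp add: symmetric_def sym_def)
qed

lemma connected_folded_hypercube: "connected (with_proj (folded_hypercube n))"
proof -
  let ?G = "with_proj (folded_hypercube n)"
  let ?R = "rtrancl_on (verts ?G) ((arcs_ends ?G)\<^sup>s)"
  have verts: "pverts (folded_hypercube n) = {x. length x = n}"
    by (simp add: folded_hypercube_def hypercube_def)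
  have reach: "(x, y) \<in> ?R"
    if "length x = n" "length y = n" "card {i. i < n \<and> x ! i \<noteq> y ! i} = d" for x y d
    using that
  proof (induction d arbitrary: x)
    case 0
    then have "x = y"
      by (auto intro: nth_equalityI)
    with 0 show ?case
      by (simp add: verts)
  next
    case (Suc d)
    then have "{i. i < n \<and> x ! i \<noteq> y ! i} \<noteq> {}"
      by (metis card.empty nat.distinct(1))
    then obtain j where j: "j < n" "x ! j \<noteq> y ! j"
      by blast
    let ?x = "x[j := y ! j]"
    have "{i. i < n \<and> ?x ! i \<noteq> y ! i} = {i. i < n \<and> x ! i \<noteq> y ! i} - {j}"
      using Suc.prems j by (auto simp: nth_list_update)
    with Suc.prems j have "card {i. i < n \<and> ?x ! i \<noteq> y ! i} = d"
      by simp
    with Suc have "(?x, y) \<in> ?R"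
      by simp
    moreover have "{i. i < n \<and> x ! i \<noteq> ?x ! i} = {j}"
      using Suc.prems j by (auto simp: nth_list_update)
    then have "(x, ?x) \<in> (arcs_ends ?G)\<^sup>s"
      using Suc.prems by (simp add: folded_hypercube_def hypercube_def symcl_def)
    ultimately show ?case
      using Suc.prems by (intro converse_rtrancl_on_into_rtrancl_on[of x ?x]) (simp_all add: verts)
  qed
  have "(x, y) \<in> ?R" if "x \<in> verts ?G" "y \<in> verts ?G" for x y
    using reach[OF _ _ refl] that by (simp add: verts)
  moreover have "replicate n False \<in> verts ?G"
    by (simp add: verts)
  ultimately show ?thesis
    unfolding connected_conv by blast
qed

end

theory Submission
  imports Defs
begin

text \<open>
  Upper bound.  Every vertex of \<open>FQ\<^sub>n\<close> has at most \<open>n + 1\<close> neighbours.  Let \<open>S\<close> contain two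
  adjacent vertices \<open>x\<close>, \<open>y\<close> and a third vertex.  In an internally disjoint family at most one tree
  uses the edge \<open>xy\<close>, and that tree has to leave \<open>{x, y}\<close> at \<open>x\<close> or at \<open>y\<close>; say at \<open>x\<close>.  Then
  every tree of the family uses an edge at \<open>x\<close> other than \<open>xy\<close>, and there are at most \<open>n\<close> of these
  (\<open>kappa_set_le_degree\<close>).

  Lower bound.  A connector for \<open>S\<close> is a connected vertex set off \<open>S\<close> that is adjacent to every
  vertex of \<open>S\<close>.  A spanning tree of a connector, with the vertices of \<open>S\<close> attached as leaves, is an
  \<open>S\<close>-tree, and disjoint connectors give internally disjoint trees (\<open>kappa_set_connectors\<close>).  So it
  suffices to find \<open>n\<close> disjoint connectors, or \<open>n - 1\<close> of them if some path on the vertex set \<open>S\<close>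
  can serve as the last tree.

  The folded hypercube is best seen with \<open>n + 1\<close> equal directions: its vertices are the subsets of
  \<open>I = {0, \<dots>, n}\<close> modulo complementation, and an edge inserts or removes one element
  (\<open>folded_coordinates\<close>).  After a translation the three vertices of \<open>S\<close> are disjoint sets \<open>X\<close>, \<open>Y\<close>,
  \<open>Z\<close>, and \<open>N\<close> is the rest of \<open>I\<close>: an element of \<open>X\<close> is a direction in which \<open>x\<close> disagrees with
  \<open>y\<close> and \<open>z\<close>, an element of \<open>N\<close> one in which all three agree.  Translating by \<open>Y \<union> Z\<close> exchanges
  \<open>N\<close> with \<open>X\<close> and \<open>Y\<close> with \<open>Z\<close>; with the permutations of \<open>S\<close> this gives all permutations of the
  four blocks.  As the three vertices are distinct, at most one block is empty, so the blocks can be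
  assumed to satisfy \<open>card X \<le> card N \<le> card Y \<le> card Z\<close> with \<open>N\<close> nonempty.

  Fix \<open>b\<close> in \<open>N\<close>.  There is one connector for each direction \<open>i \<noteq> b\<close>.  For \<open>i\<close> in \<open>N\<close> it is the star
  of the three intervals from \<open>{i}\<close> to \<open>X \<union> {i}\<close>, \<open>Y \<union> {i}\<close> and \<open>Z \<union> {i}\<close> (\<open>N_star\<close>).  For \<open>i\<close> in
  \<open>X\<close> it is the counterpart of such a star under the exchange of \<open>N\<close> and \<open>X\<close> (\<open>X_star\<close>), where the
  way from the neighbour \<open>X - {i}\<close> of \<open>x\<close> into the star starts in the direction \<open>b\<close>; this direction
  carries no star, so the stars of \<open>N\<close> are avoided.  For \<open>Y\<close> and \<open>Z\<close> this device is used up, and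
  their connectors are spiders, which run along cyclic intervals of their own block (\<open>spider\<close>).  All
  this works when \<open>Y\<close> and \<open>Z\<close> have at least two elements (\<open>family_two_large\<close>).  Otherwise \<open>N\<close> and \<open>Y\<close>
  are singletons and \<open>X\<close> is a singleton or empty; spiders still serve \<open>Z\<close> if it has at least two elements,
  and at most three other connectors have to be named.
\<close>

section \<open>Attaching a leaf to an undirected tree\<close>

definition add_leaf :: "'a pair_pre_digraph \<Rightarrow> 'a \<Rightarrow> 'a \<Rightarrow> 'a pair_pre_digraph" where
  "add_leaf T u v = \<lparr> pverts = insert v (pverts T), parcs = insert (u, v) (insert (v, u) (parcs T)) \<rparr>"

lemma add_leaf_simps [simp]:
  "pverts (add_leaf T u v) = insert v (pverts T)"
  "parcs (add_leaf T u v) = insert (u, v) (insert (v, u) (parcs T))"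
  by (simp_all add: add_leaf_def)

lemma pawalk_verts_snd: "pcas s p t \<Longrightarrow> pawalk_verts s p = s # map snd p"
  by (induction p arbitrary: s) auto

lemma pawalk_verts_fst: "pcas s p t \<Longrightarrow> pawalk_verts s p = map fst p @ [t]"
  by (induction p arbitrary: s) auto

lemma cycle_with_proj:
  "pre_digraph.cycle (with_proj T) p \<longleftrightarrow>
     (\<exists>s. s \<in> pverts T \<and> set p \<subseteq> parcs T \<and> pcas s p s \<and> distinct (map snd p) \<and> p \<noteq> [])"
  unfolding pre_digraph.cycle_def pre_digraph.awalk_def
  by (auto simp: cas_with_proj_eq awalk_verts_with_proj_eq pawalk_verts_snd)

text \<open>
  Both sides count the visits of the closed walk to each vertex.
\<close>

lemma closed_walk_sources_eq_targets:
  assumes "pcas s p s"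
  shows "mset (map fst p) = mset (map snd p)"
proof -
  have "s # map snd p = map fst p @ [s]"
    using pawalk_verts_snd[OF assms] pawalk_verts_fst[OF assms] by simp
  then have "mset (s # map snd p) = mset (map fst p @ [s])" by (rule arg_cong)
  then show ?thesis by simp
qed

lemma walk_avoids_or_stays:
  assumes "pcas s p t" "\<And>e. e \<in> set p \<Longrightarrow> fst e \<in> C \<longleftrightarrow> snd e \<in> C"
  shows "e \<in> set p \<Longrightarrow> fst e \<in> C \<longleftrightarrow> s \<in> C"
  using assms by (induction p arbitrary: s) auto

lemma undirected_tree_singleton: "undirected_tree (with_proj \<lparr> pverts = {v}, parcs = {} \<rparr>)"
proof -
  have "pair_graph \<lparr> pverts = {v}, parcs = {} \<rparr>"
    by unfold_locales (auto simp: symmetric_def sym_def)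
  then show ?thesis
    by (auto simp: undirected_tree_def connected_conv cycle_with_proj intro: pair_graph.pair_graphD_graph)
qed

text \<open>
  A new cycle would have to pass through the leaf \<open>v\<close>, hence enter it by \<open>uv\<close> and leave it by \<open>vu\<close>.
  A cycle enters and leaves \<open>u\<close> only once, so it has no other arcs and its length is 2.
\<close>

lemma undirected_tree_add_leaf:
  assumes T: "undirected_tree (with_proj T)" and u: "u \<in> pverts T" and v: "v \<notin> pverts T"
  shows "undirected_tree (with_proj (add_leaf T u v))"
proof -
  let ?T = "add_leaf T u v"
  interpret pair_graph T
    using T by (simp add: undirected_tree_def pair_graphI_graph)
  have graph: "graph (with_proj ?T)"
  proof -
    have "pair_graph ?T"
    proof
      show "symmetric (with_proj ?T)"
        using arcs_symmetric by (auto simp: symmetric_def sym_def)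
    qed (use u v pair_finite_verts pair_finite_arcs no_loops' in \<open>auto dest: in_arcsD1 in_arcsD2\<close>)
    then show ?thesis by (rule pair_graph.pair_graphD_graph)
  qed
  have conn: "connected (with_proj ?T)"
  proof -
    let ?R = "rtrancl_on (insert v (pverts T)) ((parcs ?T)\<^sup>s)"
    have sym: "sym ?R"
      by (rule rtrancl_on_sym) (auto simp: sym_def symcl_def)
    have old: "(a, b) \<in> ?R" if "a \<in> pverts T" "b \<in> pverts T" for a b
    proof (rule rtrancl_on_mono)
      show "(a, b) \<in> rtrancl_on (pverts T) ((parcs T)\<^sup>s)"
        using T that by (simp add: undirected_tree_def connected_conv)
    qed (auto simp: symcl_def)
    have uv: "(u, v) \<in> ?R"
      by (rule rtrancl_on_into_rtrancl_on[OF rtrancl_on_refl]) (use u in \<open>auto simp: symcl_def\<close>)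
    have av: "(a, v) \<in> ?R" if "a \<in> insert v (pverts T)" for a
      using that rtrancl_on_trans[OF old uv] u by auto
    have "(a, b) \<in> ?R" if "a \<in> insert v (pverts T)" "b \<in> insert v (pverts T)" for a b
      using rtrancl_on_trans[OF av[OF that(1)] symD[OF sym av[OF that(2)]]] .
    then show ?thesis by (auto simp: connected_conv)
  qed
  have "\<not> pre_digraph.cycle (with_proj ?T) p" if len: "3 \<le> length p" for p
  proof
    assume "pre_digraph.cycle (with_proj ?T) p"
    then obtain s where s: "s \<in> insert v (pverts T)" "set p \<subseteq> parcs ?T" "pcas s p s"
        "distinct (map snd p)" "p \<noteq> []"
      unfolding cycle_with_proj by (metis add_leaf_simps(1))
    have fst: "distinct (map fst p)"
      using mset_eq_imp_distinct_iff[OF closed_walk_sources_eq_targets[OF s(3)]] s(4) by simp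
    have ends: "fst ` set p = snd ` set p"
      using closed_walk_sources_eq_targets[OF s(3)] by (metis list.set_map mset_eq_setD)
    \<comment> \<open>No old arc touches the leaf.\<close>
    have at_v: "e = (u, v) \<or> e = (v, u)" if "e \<in> set p" "fst e = v \<or> snd e = v" for e
      using that s(2) v in_arcsD1 in_arcsD2 by (cases e) auto
    have inj: "e = e'" if "e \<in> set p" "e' \<in> set p" "fst e = fst e' \<or> snd e = snd e'" for e e'
      using that fst s(4) by (auto simp: distinct_map dest: inj_onD)
    show False
    proof (cases "v \<in> fst ` set p")
      case False
      have "pre_digraph.cycle (with_proj T) p"
        unfolding cycle_with_proj
      proof (intro exI conjI)
        have "fst e \<noteq> v \<and> snd e \<noteq> v" if "e \<in> set p" for e
          using that False ends by (metis image_eqI)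
        then show p: "set p \<subseteq> parcs T"
          using s(2) by fastforce
        show "s \<in> pverts T"
          using s(3,5) p by (cases p) (auto dest: in_arcsD1)
      qed (use s in auto)
      then show False
        using T len by (auto simp: undirected_tree_def)
    next
      case True
      have "\<exists>e\<in>set p. snd e = v" "\<exists>e\<in>set p. fst e = v"
        using True ends by (metis imageE)+
      then have vu: "(v, u) \<in> set p" and uv: "(u, v) \<in> set p"
        using at_v u v by fastforce+
      have only: "e \<in> {(u, v), (v, u)}" if "e \<in> set p" "fst e \<in> {u, v} \<or> snd e \<in> {u, v}" for e
        using that inj[OF that(1) vu] inj[OF that(1) uv] by auto
      have stays: "fst e \<in> {u, v} \<longleftrightarrow> snd e \<in> {u, v}" if "e \<in> set p" for e
        using only[OF that] by (metis empty_iff fst_conv insert_iff snd_conv)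
      have "fst e \<in> {u, v}" if "e \<in> set p" for e
        using walk_avoids_or_stays[OF s(3) stays, where e = e] that
          walk_avoids_or_stays[OF s(3) stays, where e = "(u, v)"] uv by simp
      then have "set p \<subseteq> {(u, v), (v, u)}"
        using only by blast
      then have "card (set p) \<le> card {(u, v), (v, u)}" by (intro card_mono) auto
      also have "\<dots> \<le> 2" by (cases "u = v") auto
      finally have "card (set p) \<le> 2" .
      moreover have "card (set p) = length p"
        using fst by (intro distinct_card) (simp add: distinct_map)
      ultimately show False
        using len by linarith
    qed
  qed
  with graph conn show ?thesis by (auto simp: undirected_tree_def)
qed

section \<open>Connectors and internally disjoint trees\<close>

definition connector :: "'a pair_pre_digraph \<Rightarrow> 'a set \<Rightarrow> 'a set \<Rightarrow> bool" where
  "connector G S W \<longleftrightarrow>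
     W \<subseteq> pverts G - S \<and>
     (\<exists>r\<in>W. \<forall>v\<in>W. (r, v) \<in> rtrancl_on W (parcs G)) \<and>
     (\<forall>s\<in>S. \<exists>w\<in>W. (w, s) \<in> parcs G)"

text \<open>
  The number of vertices outside the tree drops with each leaf: as long as the tree does not cover
  \<open>W\<close>, some edge leads out of it, since otherwise nothing outside it could be reached from \<open>r\<close>.
\<close>

lemma spanning_undirected_tree:
  assumes G: "pair_graph G" and W: "W \<subseteq> pverts G"
    and r: "r \<in> W" and reach: "\<And>v. v \<in> W \<Longrightarrow> (r, v) \<in> rtrancl_on W (parcs G)"
  obtains T where "undirected_tree (with_proj T)" "pverts T = W" "parcs T \<subseteq> parcs G"
proof -
  interpret pair_graph G by fact
  have fin: "finite W" using W pair_finite_verts finite_subset by blast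
  have grow: "\<exists>T'. undirected_tree (with_proj T') \<and> pverts T' = W \<and> parcs T' \<subseteq> parcs G"
    if "undirected_tree (with_proj T)" "pverts T \<subseteq> W" "r \<in> pverts T" "parcs T \<subseteq> parcs G" for T
    using that
  proof (induction "card (W - pverts T)" arbitrary: T rule: less_induct)
    case less
    show ?case
    proof (cases "pverts T = W")
      case False
      have "\<exists>u\<in>pverts T. \<exists>v\<in>W - pverts T. (u, v) \<in> parcs G"
      proof (rule ccontr)
        assume closed: "\<not> ?thesis"
        have "v \<in> pverts T" if "(r, v) \<in> rtrancl_on W (parcs G)" for v
          using that by (induction rule: rtrancl_on_induct) (use closed less.prems in auto)
        with False less.prems reach show False by blast
      qed
      then obtain u v where uv: "u \<in> pverts T" "v \<in> W - pverts T" "(u, v) \<in> parcs G" by blast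
      have "card (W - pverts (add_leaf T u v)) < card (W - pverts T)"
        by (rule psubset_card_mono) (use fin uv in auto)
      then show ?thesis
      proof (rule less.hyps)
        show "undirected_tree (with_proj (add_leaf T u v))"
          using undirected_tree_add_leaf less.prems uv by auto
      qed (use less.prems uv arcs_symmetric in auto)
    qed (use less.prems in blast)
  qed
  have "\<exists>T'. undirected_tree (with_proj T') \<and> pverts T' = W \<and> parcs T' \<subseteq> parcs G"
    by (rule grow[OF undirected_tree_singleton]) (use r in auto)
  then show ?thesis using that by blast
qed

lemma S_treeI:
  assumes "pair_graph G" "undirected_tree (with_proj T)" "S \<subseteq> pverts T"
    "pverts T \<subseteq> pverts G" "parcs T \<subseteq> parcs G"
  shows "S_tree G S T"
proof -
  interpret T: graph "with_proj T" using assms by (simp add: undirected_tree_def)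
  interpret G: pair_graph G by fact
  have "subgraph (with_proj T) (with_proj G)"
    using assms T.wf_digraph G.wf_digraph by (auto simp: subgraph_def compatible_def)
  with assms show ?thesis by (simp add: S_tree_def)
qed

text \<open>
  The tree has no edge inside \<open>S\<close>.  Two trees that share no vertices but those of \<open>S\<close> can
  therefore share no edges.
\<close>

lemma connector_S_tree:
  assumes G: "pair_graph G" and S: "S \<subseteq> pverts G" and W: "connector G S W"
  shows "\<exists>T. S_tree G S T \<and> pverts T = W \<union> S \<and> parcs T \<inter> S \<times> S = {}"
proof -
  interpret pair_graph G by fact
  obtain r where r: "r \<in> W" "\<And>v. v \<in> W \<Longrightarrow> (r, v) \<in> rtrancl_on W (parcs G)"
    using W by (auto simp: connector_def)
  have WG: "W \<subseteq> pverts G" "W \<inter> S = {}" using W by (auto simp: connector_def)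
  have attach: "\<exists>T. undirected_tree (with_proj T) \<and> pverts T = W \<union> S' \<and> parcs T \<subseteq> parcs G \<and>
      parcs T \<inter> S \<times> S = {}" if "finite S'" "S' \<subseteq> S" for S'
    using that
  proof (induction S')
    case empty
    obtain T where T: "undirected_tree (with_proj T)" "pverts T = W" "parcs T \<subseteq> parcs G"
      using spanning_undirected_tree[OF G WG(1) r] by blast
    then interpret T: pair_graph T by (simp add: undirected_tree_def pair_graphI_graph)
    have "parcs T \<inter> S \<times> S = {}"
      using T.in_arcsD1 WG(2) unfolding T(2) by blast
    with T show ?case by auto
  next
    case (insert s S')
    then obtain T where T: "undirected_tree (with_proj T)" "pverts T = W \<union> S'" "parcs T \<subseteq> parcs G"
      "parcs T \<inter> S \<times> S = {}" by auto
    obtain w where w: "w \<in> W" "(w, s) \<in> parcs G" using W insert by (auto simp: connector_def)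
    have "undirected_tree (with_proj (add_leaf T w s))"
      by (rule undirected_tree_add_leaf) (use T w insert WG in auto)
    then show ?case
      by (rule_tac x = "add_leaf T w s" in exI) (use T w insert WG arcs_symmetric in auto)
  qed
  have "finite S" using S pair_finite_verts finite_subset by blast
  then obtain T where T: "undirected_tree (with_proj T)" "pverts T = W \<union> S" "parcs T \<subseteq> parcs G"
      "parcs T \<inter> S \<times> S = {}"
    using attach[of S] by blast
  have "S_tree G S T"
    by (rule S_treeI[OF G T(1)]) (use T S WG in auto)
  with T show ?thesis by blast
qed

text \<open>
  The tree that consists of the edges \<open>xy\<close> and \<open>yz\<close> consumes no vertex outside \<open>S\<close>, so it can be
  added to the trees of any family of disjoint connectors.
\<close>

lemma S_tree_path:
  assumes G: "pair_graph G" and arcs: "(y, x) \<in> parcs G" "(y, z) \<in> parcs G" and "x \<noteq> z"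
  shows "\<exists>T. S_tree G {x, y, z} T \<and> pverts T = {x, y, z}"
proof -
  interpret pair_graph G by fact
  let ?T = "add_leaf (add_leaf \<lparr> pverts = {y}, parcs = {} \<rparr> y x) y z"
  have "y \<noteq> x" "y \<noteq> z" using arcs no_loops' by auto
  then have "undirected_tree (with_proj ?T)"
    using assms(4) by (intro undirected_tree_add_leaf undirected_tree_singleton) auto
  then have "S_tree G {x, y, z} ?T"
    by (rule S_treeI[OF G]) (use arcs arcs_symmetric in \<open>auto dest: in_arcsD1 in_arcsD2\<close>)
  then show ?thesis by (intro exI[of _ ?T]) auto
qed

lemma S_tree_pair_graph: "S_tree G S T \<Longrightarrow> pair_graph T"
  by (simp add: S_tree_def undirected_tree_def pair_graphI_graph)

lemma S_tree_reach:
  assumes T: "S_tree G S T" and "u \<in> S" "v \<in> S"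
  shows "(u, v) \<in> rtrancl_on (pverts T) (parcs T)"
proof -
  interpret pair_graph T using T by (rule S_tree_pair_graph)
  have "(parcs T)\<^sup>s = parcs T"
    using arcs_symmetric by (auto simp: symcl_def)
  moreover have "u \<in> pverts T" "v \<in> pverts T"
    using assms by (auto simp: S_tree_def)
  ultimately show ?thesis
    using T by (simp add: S_tree_def undirected_tree_def connected_conv)
qed

lemma card_le_kappa_set:
  assumes "finite (pverts G)" "internally_disjoint_S_trees G S \<T>"
  shows "card \<T> \<le> kappa_set G S"
  unfolding kappa_set_def
  by (rule Max_ge[OF kappa_set_finite_nonempty(1)]) (use assms in auto)

lemma kappa_set_connectors:
  assumes G: "pair_graph G" and S: "S \<subseteq> pverts G" and J: "finite J"
    and W: "\<And>j. j \<in> J \<Longrightarrow> connector G S (W j)"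
    and disj: "\<And>j j'. j \<in> J \<Longrightarrow> j' \<in> J \<Longrightarrow> j \<noteq> j' \<Longrightarrow> W j \<inter> W j' = {}"
  shows "card J \<le> kappa_set G S"
    and "S_tree G S T0 \<Longrightarrow> pverts T0 = S \<Longrightarrow> Suc (card J) \<le> kappa_set G S"
proof -
  interpret pair_graph G by fact
  obtain T where T: "\<And>j. j \<in> J \<Longrightarrow> S_tree G S (T j) \<and> pverts (T j) = W j \<union> S \<and> parcs (T j) \<inter> S \<times> S = {}"
    using connector_S_tree[OF G S W] by metis
  have WS: "W j \<noteq> {}" "W j \<inter> S = {}" if "j \<in> J" for j
    using W[OF that] by (auto simp: connector_def)
  have verts: "pverts (T j) \<inter> pverts (T j') = S" if "j \<in> J" "j' \<in> J" "j \<noteq> j'" for j j'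
    using T that disj[OF that] by auto
  have sub: "parcs T' \<subseteq> pverts T' \<times> pverts T'" if "S_tree G S T'" for T'
  proof -
    interpret T': pair_graph T' using S_tree_pair_graph that .
    show ?thesis using T'.in_arcsD1 T'.in_arcsD2 by auto
  qed
  have edges: "parcs (T j) \<inter> parcs T' = {}"
    if "j \<in> J" "S_tree G S T'" "pverts (T j) \<inter> pverts T' = S" for j T'
    using T[OF that(1)] that sub[of "T j"] sub[of T'] by blast
  have inj: "inj_on T J"
  proof (rule inj_onI, rule ccontr)
    fix j j' assume j: "j \<in> J" "j' \<in> J" "T j = T j'" "j \<noteq> j'"
    then have "pverts (T j) = S" using verts[of j j'] by simp
    then have "W j \<subseteq> S" using T[OF j(1)] by auto
    then show False using WS[OF j(1)] by auto
  qed
  have fam: "internally_disjoint_S_trees G S (T ` J)"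
    unfolding internally_disjoint_S_trees_def
  proof (intro conjI ballI impI)
    fix A assume "A \<in> T ` J"
    then obtain j where j: "j \<in> J" "A = T j" by blast
    then show "S_tree G S A" using T by blast
    fix B assume "B \<in> T ` J" "A \<noteq> B"
    then obtain j' where j': "j' \<in> J" "B = T j'" "j \<noteq> j'" using j by blast
    show "pverts A \<inter> pverts B = S" unfolding j(2) j'(2) by (rule verts) fact+
    show "parcs A \<inter> parcs B = {}" unfolding j(2) j'(2)
      by (rule edges) (use j j' T verts in auto)
  qed
  show "card J \<le> kappa_set G S"
    using card_le_kappa_set[OF pair_finite_verts fam] inj by (simp add: card_image)
  assume T0: "S_tree G S T0" "pverts T0 = S"
  have "parcs (T j) \<inter> parcs T0 = {} \<and> pverts (T j) \<inter> pverts T0 = S" if "j \<in> J" for j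
    using edges[OF that T0(1)] T[OF that] T0(2) by blast
  then have new: "parcs A \<inter> parcs T0 = {} \<and> pverts A \<inter> pverts T0 = S" if "A \<in> T ` J" for A
    using that by blast
  have "internally_disjoint_S_trees G S (insert T0 (T ` J))"
    unfolding internally_disjoint_S_trees_def
  proof (intro conjI ballI impI)
    fix A assume A: "A \<in> insert T0 (T ` J)"
    then show "S_tree G S A" using T T0 by blast
    fix B assume B: "B \<in> insert T0 (T ` J)" and "A \<noteq> B"
    then consider "A \<in> T ` J" "B \<in> T ` J" | "A \<in> T ` J" "B = T0" | "B \<in> T ` J" "A = T0"
      using A by blast
    then have "parcs A \<inter> parcs B = {} \<and> pverts A \<inter> pverts B = S"
    proof cases
      case 1
      then show ?thesis
        using fam \<open>A \<noteq> B\<close> unfolding internally_disjoint_S_trees_def by blast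
    next
      case 2
      then show ?thesis using new by blast
    next
      case 3
      then show ?thesis using new[of B] by (simp add: Int_commute)
    qed
    then show "parcs A \<inter> parcs B = {}" "pverts A \<inter> pverts B = S" by simp_all
  qed
  moreover have "T0 \<notin> T ` J"
  proof
    assume "T0 \<in> T ` J"
    then obtain j where j: "j \<in> J" "T0 = T j" by auto
    then have "W j \<subseteq> S" using T[OF j(1)] T0 by auto
    then show False using WS[OF j(1)] by auto
  qed
  moreover have "card (insert T0 (T ` J)) = Suc (card J)"
    using calculation(2) J by (simp add: card_image[OF inj])
  ultimately show "Suc (card J) \<le> kappa_set G S"
    using card_le_kappa_set[OF pair_finite_verts] by metis
qed

text \<open>
  If some tree had no arc from \<open>x\<close> except to \<open>y\<close>, and some tree no arc from \<open>y\<close> except to \<open>x\<close>, both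
  would contain the edge \<open>xy\<close>, so they would be the same tree, and this tree could not reach the third
  vertex.  So at \<open>x\<close> or at \<open>y\<close> every tree has an arc other than the arc \<open>xy\<close>, and these arcs are
  distinct.
\<close>

lemma kappa_set_le_degree:
  assumes G: "pair_graph G" and xy: "(x, y) \<in> parcs G" and S: "S \<subseteq> pverts G" "x \<in> S" "y \<in> S" "S - {x, y} \<noteq> {}"
    and deg: "card {w. (x, w) \<in> parcs G} \<le> Suc d" "card {w. (y, w) \<in> parcs G} \<le> Suc d"
  shows "kappa_set G S \<le> d"
proof -
  interpret pair_graph G by fact
  have bound: "card \<T> \<le> d"
    if fam: "internally_disjoint_S_trees G S \<T>" and uv: "(u, v) \<in> parcs G"
      and deg: "card {w. (u, w) \<in> parcs G} \<le> Suc d"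
      and ex: "\<forall>T\<in>\<T>. \<exists>w. (u, w) \<in> parcs T \<and> w \<noteq> v" for \<T> u v
  proof -
    obtain f where f: "\<And>T. T \<in> \<T> \<Longrightarrow> (u, f T) \<in> parcs T \<and> f T \<noteq> v"
      using ex by metis
    have fin: "finite {w. (u, w) \<in> parcs G}"
      by (rule finite_subset[OF _ pair_finite_verts]) (auto dest: in_arcsD2)
    have "parcs T \<subseteq> parcs G" if "T \<in> \<T>" for T
      using fam that by (auto simp: internally_disjoint_S_trees_def S_tree_def subgraph_def)
    then have "f ` \<T> \<subseteq> {w. (u, w) \<in> parcs G} - {v}" using f by blast
    moreover have "inj_on f \<T>"
    proof (rule inj_onI, rule ccontr)
      fix T T' assume T: "T \<in> \<T>" "T' \<in> \<T>" "f T = f T'" "T \<noteq> T'"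
      then have "parcs T \<inter> parcs T' = {}" using fam by (auto simp: internally_disjoint_S_trees_def)
      then show False using f[OF T(1)] f[OF T(2)] T(3) by auto
    qed
    ultimately have "card \<T> \<le> card ({w. (u, w) \<in> parcs G} - {v})"
      using fin by (metis card_inj_on_le finite_Diff)
    also have "\<dots> \<le> d" using uv fin deg by simp
    finally show ?thesis .
  qed
  have "card \<T> \<le> d" if fam: "internally_disjoint_S_trees G S \<T>" for \<T>
  proof -
    consider "\<forall>T\<in>\<T>. \<exists>w. (x, w) \<in> parcs T \<and> w \<noteq> y" | "\<forall>T\<in>\<T>. \<exists>w. (y, w) \<in> parcs T \<and> w \<noteq> x"
      | T T' where "T \<in> \<T>" "\<And>w. (x, w) \<in> parcs T \<Longrightarrow> w = y" "T' \<in> \<T>" "\<And>w. (y, w) \<in> parcs T' \<Longrightarrow> w = x"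
      by blast
    then show ?thesis
    proof cases
      case 1 then show ?thesis using bound[OF fam xy deg(1)] by blast
    next
      case 2 then show ?thesis using bound[OF fam arcs_symmetric[OF xy] deg(2)] by blast
    next
      case 3
      have nbr: "\<exists>w. (u, w) \<in> parcs T''" if "T'' \<in> \<T>" "u \<in> S" "u' \<in> S" "u \<noteq> u'" for T'' u u'
      proof (rule ccontr)
        assume none: "\<not> ?thesis"
        have T'': "S_tree G S T''" using fam that by (auto simp: internally_disjoint_S_trees_def)
        have "(u, u') \<in> rtrancl_on (pverts T'') (parcs T'')"
          by (rule S_tree_reach[OF T'']) fact+
        then have "u' = u"
          by (induction rule: rtrancl_on_induct) (use none in auto)
        with that show False by simp
      qed
      have "x \<noteq> y" using xy no_loops' by blast
      then have "(x, y) \<in> parcs T" "(y, x) \<in> parcs T'"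
        using nbr[of T x y] nbr[of T' y x] 3 S by blast+
      moreover have "(x, y) \<in> parcs T'"
      proof -
        interpret T': pair_graph T'
          using fam 3 by (auto simp: internally_disjoint_S_trees_def intro: S_tree_pair_graph)
        show ?thesis using T'.arcs_symmetric calculation by blast
      qed
      ultimately have "parcs T \<inter> parcs T' \<noteq> {}" by blast
      then have eq: "T' = T"
        using fam 3(1,3) unfolding internally_disjoint_S_trees_def by metis
      obtain z where z: "z \<in> S" "z \<noteq> x" "z \<noteq> y" using S by blast
      have T: "S_tree G S T" using fam 3 by (auto simp: internally_disjoint_S_trees_def)
      have "(x, z) \<in> rtrancl_on (pverts T) (parcs T)"
        by (rule S_tree_reach[OF T]) fact+
      then have "z \<in> {x, y}"
        by (induction rule: rtrancl_on_induct) (use 3 eq in auto)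
      with z show ?thesis by simp
    qed
  qed
  then show ?thesis
    unfolding kappa_set_def
    using kappa_set_finite_nonempty[OF pair_finite_verts, of S] by (intro Max.boundedI) auto
qed

section \<open>Subsets modulo complementation\<close>

definition flips :: "'a set rel" where
  "flips = {(A, B). \<exists>i. i \<notin> A \<and> B = insert i A \<or> i \<notin> B \<and> A = insert i B}"

lemma flips_insert: "i \<notin> A \<Longrightarrow> (A, insert i A) \<in> flips" "i \<notin> A \<Longrightarrow> (insert i A, A) \<in> flips"
  by (auto simp: flips_def)

lemma flips_remove:
  assumes "i \<in> A"
  shows "(A - {i}, A) \<in> flips" "(A, A - {i}) \<in> flips"
  using flips_insert[of i "A - {i}"] assms by (simp_all add: insert_absorb)

lemma sym_flips: "sym flips"
  by (auto simp: flips_def sym_def)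

lemma sym_reach: "sym (rtrancl_on \<W> flips)"
  by (rule rtrancl_on_sym[OF sym_flips])

text \<open>
  Most connectors below are unions of intervals of the subset order, in which one gets from bottom to
  top by inserting the missing elements one at a time.
\<close>

lemma reach_interval:
  assumes "finite B" "A \<subseteq> B" "\<And>C. A \<subseteq> C \<Longrightarrow> C \<subseteq> B \<Longrightarrow> C \<in> \<W>"
  shows "(A, B) \<in> rtrancl_on \<W> flips" "(B, A) \<in> rtrancl_on \<W> flips"
proof -
  have "(A, A \<union> D) \<in> rtrancl_on \<W> flips" if "finite D" "D \<subseteq> B - A" for D
    using that
  proof (induction D)
    case empty
    then show ?case using assms(2,3) by auto
  next
    case (insert d D)
    have d: "d \<notin> A \<union> D" "D \<subseteq> B - A" "A \<union> insert d D \<subseteq> B"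
      using insert.hyps insert.prems assms(2) by auto
    have "(A, A \<union> D) \<in> rtrancl_on \<W> flips"
      by (rule insert.IH[OF d(2)])
    moreover have "(A \<union> D, A \<union> insert d D) \<in> flips"
      using flips_insert(1)[OF d(1)] by simp
    moreover have "A \<union> insert d D \<in> \<W>"
      by (rule assms(3)[OF _ d(3)]) blast
    ultimately show ?case
      by (rule rtrancl_on_into_rtrancl_on)
  qed
  from this[of "B - A"] show *: "(A, B) \<in> rtrancl_on \<W> flips"
    using assms(1,2) by (simp add: Un_absorb1)
  then show "(B, A) \<in> rtrancl_on \<W> flips" using sym_reach symD by metis
qed

text \<open>
  The map \<open>\<phi>\<close> presents the vertices of \<open>G\<close> as subsets of \<open>I\<close> modulo complementation.  This treats
  the complementary edges of a folded hypercube in the same way as the edges of the cube: for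
  \<open>I = {..n}\<close> the element \<open>n\<close> is the direction of the complementary edges.
\<close>

definition folded_coordinates ::
    "'v pair_pre_digraph \<Rightarrow> 'a set \<Rightarrow> ('a set \<Rightarrow> 'v) \<Rightarrow> bool" where
  "folded_coordinates G I \<phi> \<longleftrightarrow>
     (\<forall>A\<subseteq>I. \<phi> A \<in> pverts G \<and> \<phi> (I - A) = \<phi> A) \<and>
     (\<forall>A\<subseteq>I. \<forall>B\<subseteq>I. \<phi> A = \<phi> B \<longrightarrow> B = A \<or> B = I - A) \<and>
     (\<forall>A\<subseteq>I. \<forall>B\<subseteq>I. (A, B) \<in> flips \<longrightarrow> (\<phi> A, \<phi> B) \<in> parcs G)"

lemma folded_coordinatesD:
  assumes "folded_coordinates G I \<phi>" "A \<subseteq> I"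
  shows "\<phi> A \<in> pverts G" "\<phi> (I - A) = \<phi> A"
    "B \<subseteq> I \<Longrightarrow> \<phi> A = \<phi> B \<Longrightarrow> B = A \<or> B = I - A"
    "B \<subseteq> I \<Longrightarrow> (A, B) \<in> flips \<Longrightarrow> (\<phi> A, \<phi> B) \<in> parcs G"
  using assms by (simp_all add: folded_coordinates_def)

text \<open>
  Every vertex can be made the origin.  This is the source of the symmetry between the four blocks.
\<close>

lemma folded_coordinates_translate:
  assumes \<phi>: "folded_coordinates G I \<phi>" and D: "D \<subseteq> I"
  shows "folded_coordinates G I (\<lambda>A. \<phi> (sym_diff A D))"
proof -
  have compl: "sym_diff (I - A) D = I - sym_diff A D" if "A \<subseteq> I" for A
    using that D by blast
  have inj: "A = B" if "sym_diff A D = sym_diff B D" for A B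
  proof -
    have "sym_diff (sym_diff A D) D = sym_diff (sym_diff B D) D" by (simp only: that)
    moreover have "sym_diff (sym_diff C D) D = C" for C by blast
    ultimately show ?thesis by simp
  qed
  have flip: "(sym_diff A D, sym_diff B D) \<in> flips" if AB: "(A, B) \<in> flips" for A B
  proof -
    have one: "(sym_diff A D, sym_diff (insert i A) D) \<in> flips" if "i \<notin> A" for i A
    proof (cases "i \<in> D")
      case True
      then have "sym_diff (insert i A) D = sym_diff A D - {i}" "i \<in> sym_diff A D" using that by auto
      then show ?thesis using flips_remove(2) by metis
    next
      case False
      then have "sym_diff (insert i A) D = insert i (sym_diff A D)" "i \<notin> sym_diff A D" using that by auto
      then show ?thesis using flips_insert(1) by metis
    qed
    from AB obtain i where "i \<notin> A \<and> B = insert i A \<or> i \<notin> B \<and> A = insert i B"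
      by (auto simp: flips_def)
    then show ?thesis using one[of i A] symD[OF sym_flips one[of i B]] by blast
  qed
  have sub: "sym_diff A D \<subseteq> I" if "A \<subseteq> I" for A using that D by blast
  show ?thesis
    unfolding folded_coordinates_def
  proof (intro conjI allI impI)
    fix A assume A: "A \<subseteq> I"
    show "\<phi> (sym_diff A D) \<in> pverts G" "\<phi> (sym_diff (I - A) D) = \<phi> (sym_diff A D)"
      using \<phi> sub[OF A] unfolding compl[OF A] by (auto simp: folded_coordinates_def)
    fix B assume B: "B \<subseteq> I"
    show "(\<phi> (sym_diff A D), \<phi> (sym_diff B D)) \<in> parcs G" if "(A, B) \<in> flips"
      using \<phi> sub[OF A] sub[OF B] flip[OF that] unfolding folded_coordinates_def by blast
    assume "\<phi> (sym_diff A D) = \<phi> (sym_diff B D)"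
    then have "sym_diff B D = sym_diff A D \<or> sym_diff B D = sym_diff (I - A) D"
      using \<phi> sub[OF A] sub[OF B] unfolding compl[OF A] folded_coordinates_def by blast
    then show "B = A \<or> B = I - A" using inj by blast
  qed
qed

text \<open>
  Connectors, written in coordinates: a set \<open>T\<close> and its complement denote the same vertex.
\<close>

definition cube_connector :: "'a set \<Rightarrow> 'a set set \<Rightarrow> 'a set set \<Rightarrow> bool" where
  "cube_connector I \<S> \<W> \<longleftrightarrow>
     \<W> \<subseteq> Pow I \<and>
     (\<exists>R\<in>\<W>. \<forall>A\<in>\<W>. (R, A) \<in> rtrancl_on \<W> flips) \<and>
     (\<forall>T\<in>\<S>. T \<notin> \<W> \<and> I - T \<notin> \<W> \<and> (\<exists>A\<in>\<W>. (A, T) \<in> flips \<or> (A, I - T) \<in> flips))"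

definition apart :: "'a set \<Rightarrow> 'a set set \<Rightarrow> 'a set set \<Rightarrow> bool" where
  "apart I \<V> \<W> \<longleftrightarrow> (\<forall>A\<in>\<V>. A \<notin> \<W> \<and> I - A \<notin> \<W>)"

lemma apart_image_disjoint:
  assumes "folded_coordinates G I \<phi>" "\<V> \<subseteq> Pow I" "\<W> \<subseteq> Pow I" "apart I \<V> \<W>"
  shows "\<phi> ` \<V> \<inter> \<phi> ` \<W> = {}"
proof (rule ccontr)
  assume "\<phi> ` \<V> \<inter> \<phi> ` \<W> \<noteq> {}"
  then obtain A B where AB: "A \<in> \<V>" "B \<in> \<W>" "\<phi> A = \<phi> B" by auto
  moreover have "A \<subseteq> I" "B \<subseteq> I" using AB assms(2,3) by auto
  ultimately have "B = A \<or> B = I - A"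
    using folded_coordinatesD(3)[OF assms(1)] by simp
  with AB assms(4) show False unfolding apart_def by blast
qed

lemma cube_connector_image:
  assumes \<phi>: "folded_coordinates G I \<phi>" and \<S>: "\<S> \<subseteq> Pow I" and \<W>: "cube_connector I \<S> \<W>"
  shows "connector G (\<phi> ` \<S>) (\<phi> ` \<W>)"
proof -
  have WI: "\<W> \<subseteq> Pow I" using \<W> by (simp add: cube_connector_def)
  have edge: "(\<phi> A, \<phi> B) \<in> parcs G" if "A \<subseteq> I" "B \<subseteq> I" "(A, B) \<in> flips" for A B
    by (rule folded_coordinatesD(4)[OF \<phi>]) fact+
  have lift: "(\<phi> R, \<phi> A) \<in> rtrancl_on (\<phi> ` \<W>) (parcs G)" if "(R, A) \<in> rtrancl_on \<W> flips" for R A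
    using that
  proof (induction rule: rtrancl_on_induct)
    case (step B C)
    moreover from step have "(\<phi> B, \<phi> C) \<in> parcs G" using WI by (intro edge) auto
    ultimately show ?case by (auto intro: rtrancl_on_into_rtrancl_on)
  qed auto
  have "apart I \<W> \<S>"
    unfolding apart_def
  proof
    fix A assume A: "A \<in> \<W>"
    then have "I - (I - A) = A" using WI by auto
    then show "A \<notin> \<S> \<and> I - A \<notin> \<S>"
      using A \<W> unfolding cube_connector_def by metis
  qed
  then have "\<phi> ` \<W> \<inter> \<phi> ` \<S> = {}" using apart_image_disjoint \<phi> WI \<S> by blast
  moreover have "\<phi> ` \<W> \<subseteq> pverts G" using folded_coordinatesD(1)[OF \<phi>] WI by auto
  moreover obtain R where R: "R \<in> \<W>" "\<And>A. A \<in> \<W> \<Longrightarrow> (R, A) \<in> rtrancl_on \<W> flips"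
    using \<W> unfolding cube_connector_def by blast
  moreover have "\<forall>v\<in>\<phi> ` \<W>. (\<phi> R, v) \<in> rtrancl_on (\<phi> ` \<W>) (parcs G)"
    using lift R by simp
  moreover have "\<exists>w\<in>\<phi> ` \<W>. (w, \<phi> T) \<in> parcs G" if T: "T \<in> \<S>" for T
  proof -
    obtain A where A: "A \<in> \<W>" "(A, T) \<in> flips \<or> (A, I - T) \<in> flips"
      using \<W> T unfolding cube_connector_def by blast
    moreover have "T \<subseteq> I" using \<S> T by auto
    moreover from this have "\<phi> (I - T) = \<phi> T" by (rule folded_coordinatesD(2)[OF \<phi>])
    moreover have "A \<subseteq> I" using A WI by blast
    ultimately have "(\<phi> A, \<phi> T) \<in> parcs G"
      using edge[of A T] edge[of A "I - T"] by auto
    then show ?thesis using A by blast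
  qed
  ultimately show ?thesis unfolding connector_def by (intro conjI bexI[of _ "\<phi> R"]) auto
qed

text \<open>
  The chains \<open>\<C> k\<close> lead from the co-singleton \<open>Z - {k}\<close> to some singleton through proper nonempty
  subsets of \<open>Z\<close>.  They are the arms of the spiders.
\<close>

definition disjoint_chains :: "'a set \<Rightarrow> ('a \<Rightarrow> 'a set set) \<Rightarrow> bool" where
  "disjoint_chains Z \<C> \<longleftrightarrow>
     (\<forall>k\<in>Z. \<C> k \<subseteq> Pow Z - {{}, Z} \<and> Z - {k} \<in> \<C> k \<and> (\<exists>t\<in>Z. {t} \<in> \<C> k) \<and>
        (\<forall>A\<in>\<C> k. (Z - {k}, A) \<in> rtrancl_on (\<C> k) flips) \<and>
        (\<forall>l\<in>Z. l \<noteq> k \<longrightarrow> \<C> k \<inter> \<C> l = {}))"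

lemma add_mod_cancel:
  fixes a i j c :: nat
  assumes "(a + i) mod c = (a + j) mod c" "i < c" "j < c"
  shows "i = j"
proof -
  have *: "j \<le> i" if "(a + i) mod c = (a + j) mod c" "i < c" "j < c" for i j :: nat
  proof (rule ccontr)
    assume "\<not> j \<le> i"
    then have "c dvd (a + j) - (a + i)" using that(1) by (subst mod_eq_dvd_iff_nat[symmetric]) auto
    then show False using \<open>\<not> j \<le> i\<close> that(3) by (auto dest: dvd_imp_le)
  qed
  from *[OF assms] *[OF assms(1)[symmetric] assms(3,2)] show ?thesis by simp
qed

definition cyclic_interval :: "nat \<Rightarrow> nat \<Rightarrow> nat \<Rightarrow> nat set" where
  "cyclic_interval c a m = (\<lambda>i. (a + i) mod c) ` {..<m}"

lemma cyclic_interval_omits: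
  assumes "m < c" shows "(a + m) mod c \<notin> cyclic_interval c a m"
proof
  assume "(a + m) mod c \<in> cyclic_interval c a m"
  then obtain j where "(a + m) mod c = (a + j) mod c" "j < m"
    by (auto simp: cyclic_interval_def)
  then show False
    using add_mod_cancel[of a m c j] assms by simp
qed

text \<open>
  The start of a cyclic interval is its only element whose cyclic predecessor lies outside, so a
  proper nonempty interval determines its start.
\<close>

lemma cyclic_interval_start:
  assumes m: "0 < m" "m < c" and n: "0 < n" "n < c"
    and eq: "cyclic_interval c a m = cyclic_interval c b n"
  shows "a mod c = b mod c"
proof (rule ccontr)
  assume ne: "a mod c \<noteq> b mod c"
  have "a mod c \<in> cyclic_interval c a m" using m by (force simp: cyclic_interval_def)
  then obtain i where i: "a mod c = (b + i) mod c" "i < n" unfolding eq by (auto simp: cyclic_interval_def)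
  have "i \<noteq> 0" using ne i(1) by (intro notI) simp
  \<comment> \<open>If the two starts differ, the cyclic predecessor of \<open>a\<close> still belongs to the interval from \<open>b\<close>.\<close>
  then have "(a + (c - 1)) mod c = (b + (i - 1)) mod c"
  proof -
    have "(a + (c - 1)) mod c = (a mod c + (c - 1)) mod c" by (simp add: mod_simps)
    also have "\<dots> = (b + i + (c - 1)) mod c" unfolding i(1) by (simp add: mod_simps)
    also have "b + i + (c - 1) = b + (i - 1) + c" using \<open>i \<noteq> 0\<close> m by simp
    finally show ?thesis by simp
  qed
  then have "(a + (c - 1)) mod c \<in> cyclic_interval c a m"
    using i unfolding eq unfolding cyclic_interval_def by auto
  then obtain j where "(a + (c - 1)) mod c = (a + j) mod c" "j < m"
    unfolding cyclic_interval_def by blast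
  then show False
    using add_mod_cancel[of a "c - 1" c j] m by simp
qed

text \<open>
  Number \<open>Z\<close> cyclically.  The chain of \<open>k\<close> consists of the cyclic intervals that start right after
  \<open>k\<close>; the longest proper one is \<open>Z - {k}\<close>.  Chains of different elements are disjoint because an
  interval determines its start.
\<close>

lemma ex_disjoint_chains:
  fixes Z :: "'a set"
  assumes Z: "finite Z" "2 \<le> card Z"
  shows "\<exists>\<C>. disjoint_chains Z \<C>"
proof -
  define c where "c = card Z"
  have c: "2 \<le> c" using Z by (simp add: c_def)
  obtain e where e: "bij_betw e {..<c} Z"
    using ex_bij_betw_nat_finite[OF Z(1)] by (auto simp: c_def atLeast0LessThan)
  let ?P = "cyclic_interval c"
  \<comment> \<open>Intervals that start at \<open>Suc k\<close> and stop before they come round to \<open>k\<close>.\<close>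
  define \<D> where "\<D> k = {e ` ?P (Suc k) m | m. 0 < m \<and> m < c}" for k
  define \<C> where "\<C> x = \<D> (inv_into {..<c} e x)" for x
  have P: "?P a m \<subseteq> {..<c}" for a m using c by (auto simp: cyclic_interval_def)
  have inj: "inj_on e {..<c}" using e by (rule bij_betw_imp_inj_on)
  have img: "e ` {..<c} = Z" using e by (rule bij_betw_imp_surj_on)
  have eq: "A = B" if "e ` A = e ` B" "A \<subseteq> {..<c}" "B \<subseteq> {..<c}" for A B
    using inj_on_image_eq_iff[OF inj that(2,3)] that(1) by blast
  have card_P: "card (?P a m) = m" if "m \<le> c" for a m
  proof -
    have "inj_on (\<lambda>i. (a + i) mod c) {..<m}"
      by (rule inj_onI, rule add_mod_cancel[of a _ c]) (use that in auto)
    then show ?thesis by (simp add: cyclic_interval_def card_image)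
  qed
  have full: "e ` ?P (Suc k) (c - 1) = Z - {e k}" if k: "k < c" for k
  proof -
    have "k \<notin> ?P (Suc k) (c - 1)"
      using cyclic_interval_omits[of "c - 1" c "Suc k"] c k by simp
    then have "?P (Suc k) (c - 1) \<subseteq> {..<c} - {k}" using P by blast
    then have "?P (Suc k) (c - 1) = {..<c} - {k}"
      by (rule card_subset_eq[rotated]) (use card_P k in auto)
    then show ?thesis
      using inj_on_image_set_diff[OF inj, of "{..<c}" "{k}"] k img by auto
  qed
  have \<D>: "\<D> k \<subseteq> Pow Z - {{}, Z} \<and> Z - {e k} \<in> \<D> k \<and> (\<exists>t\<in>Z. {t} \<in> \<D> k) \<and>
        (\<forall>A\<in>\<D> k. (Z - {e k}, A) \<in> rtrancl_on (\<D> k) flips) \<and>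
        (\<forall>l<c. l \<noteq> k \<longrightarrow> \<D> k \<inter> \<D> l = {})" if k: "k < c" for k
  proof (intro conjI ballI allI impI)
    show "\<D> k \<subseteq> Pow Z - {{}, Z}"
    proof
      fix A assume "A \<in> \<D> k"
      then obtain m where m: "A = e ` ?P (Suc k) m" "0 < m" "m < c" unfolding \<D>_def by blast
      have "card A = m"
        unfolding m(1) using card_image[OF inj_on_subset[OF inj P]] card_P m by simp
      moreover have "A \<subseteq> Z" using P img m(1) by blast
      ultimately show "A \<in> Pow Z - {{}, Z}" using m c_def by auto
    qed
    show "Z - {e k} \<in> \<D> k" unfolding full[OF k, symmetric] \<D>_def using c by (intro CollectI exI[of _ "c - 1"]) simp
    have "{e (Suc k mod c)} = e ` ?P (Suc k) 1" by (simp add: cyclic_interval_def lessThan_Suc)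
    then have "{e (Suc k mod c)} \<in> \<D> k" using c unfolding \<D>_def by (intro CollectI exI[of _ 1]) simp
    moreover have "e (Suc k mod c) \<in> Z" using c img by auto
    ultimately show "\<exists>t\<in>Z. {t} \<in> \<D> k" by blast
    have reach: "(e ` ?P (Suc k) (c - 1), e ` ?P (Suc k) m) \<in> rtrancl_on (\<D> k) flips" if "m \<le> c - 1" "0 < m" for m
      using that
    proof (induction rule: inc_induct)
      case base
      then have "e ` ?P (Suc k) (c - 1) \<in> \<D> k" using c unfolding \<D>_def by (intro CollectI exI[of _ "c - 1"]) simp
      then show ?case by simp
    next
      case (step m)
      let ?i = "(Suc k + m) mod c"
      have "?i \<notin> ?P (Suc k) m" using step by (intro cyclic_interval_omits) auto
      then have "e ?i \<notin> e ` ?P (Suc k) m"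
        using inj_on_image_mem_iff[OF inj _ P] c by auto
      moreover have "e ` ?P (Suc k) (Suc m) = insert (e ?i) (e ` ?P (Suc k) m)"
        by (simp add: cyclic_interval_def lessThan_Suc)
      ultimately have "(e ` ?P (Suc k) (Suc m), e ` ?P (Suc k) m) \<in> flips"
        using flips_insert(2) by metis
      moreover have "e ` ?P (Suc k) m \<in> \<D> k" using step unfolding \<D>_def by (intro CollectI exI[of _ m]) simp
      ultimately show ?case using step by (intro rtrancl_on_into_rtrancl_on[OF step.IH]) auto
    qed
    show "(Z - {e k}, A) \<in> rtrancl_on (\<D> k) flips" if A: "A \<in> \<D> k" for A
    proof -
      obtain m where "A = e ` ?P (Suc k) m" "0 < m" "m < c" using A unfolding \<D>_def by blast
      then show ?thesis using reach[of m] unfolding full[OF k] by simp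
    qed
    show "\<D> k \<inter> \<D> l = {}" if l: "l < c" "l \<noteq> k" for l
    proof (rule ccontr)
      assume "\<D> k \<inter> \<D> l \<noteq> {}"
      then obtain m n where mn: "0 < m" "m < c" "0 < n" "n < c"
          "e ` ?P (Suc k) m = e ` ?P (Suc l) n" unfolding \<D>_def by blast
      then have "Suc k mod c = Suc l mod c"
        using cyclic_interval_start[OF mn(1-4) eq[OF mn(5) P P]] by simp
      then show False using add_mod_cancel[of 1 k c l] k l by simp
    qed
  qed
  have "disjoint_chains Z \<C>"
    unfolding disjoint_chains_def
  proof
    fix x assume "x \<in> Z"
    then obtain k where k: "k < c" "x = e k" using img by auto
    have \<C>: "\<C> (e l) = \<D> l" if "l < c" for l
      using that inj by (simp add: \<C>_def)
    have "\<C> x \<inter> \<C> y = {}" if y: "y \<in> Z" "y \<noteq> x" for y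
    proof -
      obtain l where l: "l < c" "y = e l" using y(1) img by auto
      then have "\<D> k \<inter> \<D> l = {}" using \<D>[OF k(1)] k(2) y(2) by blast
      then show ?thesis unfolding k(2) l(2) \<C>[OF k(1)] \<C>[OF l(1)] .
    qed
    with \<D>[OF k(1)] show "\<C> x \<subseteq> Pow Z - {{}, Z} \<and> Z - {x} \<in> \<C> x \<and> (\<exists>t\<in>Z. {t} \<in> \<C> x) \<and>
        (\<forall>A\<in>\<C> x. (Z - {x}, A) \<in> rtrancl_on (\<C> x) flips) \<and>
        (\<forall>l\<in>Z. l \<noteq> x \<longrightarrow> \<C> x \<inter> \<C> l = {})"
      unfolding k(2) \<C>[OF k(1)] by blast
  qed
  then show ?thesis by (intro exI[of _ \<C>])
qed

section \<open>Three kinds of connectors\<close>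

text \<open>
  Write a set as \<open>(N', X', Y', Z')\<close>, its parts in the four blocks.  The star of \<open>i\<close> has centre
  \<open>({i}, {}, {}, {})\<close> and contains the subcubes \<open>({i}, *, {}, {})\<close>, \<open>({i}, {}, *, {})\<close> and
  \<open>({i}, {}, {}, *)\<close>, each of which ends at a neighbour of one of the three vertices.
\<close>

definition N_star :: "'a set \<Rightarrow> 'a set \<Rightarrow> 'a set \<Rightarrow> 'a set \<Rightarrow> 'a \<Rightarrow> 'a set set" where
  "N_star N X Y Z i =
     {A. A \<subseteq> N \<union> X \<union> Y \<union> Z \<and> A \<inter> N = {i} \<and>
        (A \<inter> X = {} \<and> A \<inter> Y = {} \<or> A \<inter> X = {} \<and> A \<inter> Z = {} \<or> A \<inter> Y = {} \<and> A \<inter> Z = {})}"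

text \<open>
  In the direction \<open>j \<in> X\<close>, the neighbour of \<open>x\<close> is \<open>({}, X - {j}, {}, {})\<close>, and those of \<open>y\<close> and \<open>z\<close>
  are, after complementation, \<open>(N, X - {j}, {}, Z)\<close> and \<open>(N, X - {j}, Y, {})\<close>.  All three are joined to
  \<open>(N, X - {j}, {}, {})\<close>.  The way from \<open>x\<close> through \<open>(*, X - {j}, {}, {})\<close> inserts \<open>b\<close> first, which
  keeps it away from the stars of \<open>N\<close>.
\<close>

definition X_star :: "'a \<Rightarrow> 'a set \<Rightarrow> 'a set \<Rightarrow> 'a set \<Rightarrow> 'a set \<Rightarrow> 'a \<Rightarrow> 'a set set" where
  "X_star b N X Y Z j =
     {A. A \<subseteq> N \<union> X \<union> Y \<union> Z \<and> A \<inter> X = X - {j} \<and>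
        (A \<inter> Y = {} \<and> A \<inter> Z = {} \<and> (A \<inter> N = {} \<or> b \<in> A) \<or>
         N \<subseteq> A \<and> (A \<inter> Y = {} \<or> A \<inter> Z = {}))}"

text \<open>
  The neighbours of \<open>z\<close> and \<open>y\<close> in the direction \<open>k \<in> Z\<close> are \<open>({}, {}, {}, Z - {k})\<close> and, after
  complementation, \<open>(N, X, {}, Z - {k})\<close>.  They are joined by inserting \<open>X\<close> first, then \<open>b\<close>, then the
  rest of \<open>N\<close>.  From \<open>({}, X, {}, Z - {k})\<close> on this way the arm \<open>({}, X, {}, \<C> k)\<close> leads to a
  neighbour \<open>X \<union> {t}\<close> of \<open>x\<close>, whose direction \<open>t\<close> may differ from \<open>k\<close>.
\<close>

definition spider :: "'a \<Rightarrow> ('a \<Rightarrow> 'a set set) \<Rightarrow> 'a set \<Rightarrow> 'a set \<Rightarrow> 'a set \<Rightarrow> 'a set \<Rightarrow> 'a \<Rightarrow> 'a set set" where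
  "spider b \<C> N X Y Z k =
     {A. A \<subseteq> N \<union> X \<union> Y \<union> Z \<and> A \<inter> Y = {} \<and>
        (A \<inter> Z = Z - {k} \<and> (A \<inter> N = {} \<or> X \<subseteq> A \<and> b \<in> A) \<or>
         A \<inter> N = {} \<and> X \<subseteq> A \<and> A \<inter> Z \<in> \<C> k)}"

lemma X_star_topI:
  assumes "A \<subseteq> N \<union> X \<union> Y \<union> Z" "A \<inter> X = X - {j}" "N \<subseteq> A" "A \<inter> Y = {} \<or> A \<inter> Z = {}"
  shows "A \<in> X_star b N X Y Z j"
  using assms unfolding X_star_def by simp

lemma spider_bodyI:
  assumes "A \<subseteq> N \<union> X \<union> Y \<union> Z" "A \<inter> Y = {}" "A \<inter> Z = Z - {k}" "A \<inter> N = {} \<or> X \<subseteq> A \<and> b \<in> A"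
  shows "A \<in> spider b \<C> N X Y Z k"
  using assms unfolding spider_def by simp

lemma spider_armI:
  assumes "A \<subseteq> N \<union> X \<union> Y \<union> Z" "A \<inter> Y = {}" "A \<inter> N = {}" "X \<subseteq> A" "A \<inter> Z \<in> \<C> k"
  shows "A \<in> spider b \<C> N X Y Z k"
  using assms unfolding spider_def by simp

locale four_parts =
  fixes N X Y Z :: "'a set"
  assumes fin: "finite N" "finite X" "finite Y" "finite Z"
    and disj: "N \<inter> X = {}" "N \<inter> Y = {}" "N \<inter> Z = {}" "X \<inter> Y = {}" "X \<inter> Z = {}" "Y \<inter> Z = {}"
begin

abbreviation I where "I \<equiv> N \<union> X \<union> Y \<union> Z"

lemma swap_YZ: "four_parts N X Z Y"
  using fin disj by unfold_locales auto

lemma N_star_cube_connector: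
  assumes i: "i \<in> N" and b: "b \<in> N" "b \<noteq> i"
  shows "cube_connector I {X, Y, Z} (N_star N X Y Z i)"
  unfolding cube_connector_def
proof (intro conjI ballI)
  let ?W = "N_star N X Y Z i"
  show "?W \<subseteq> Pow I" by (auto simp: N_star_def)
  have root: "{i} \<in> ?W" using i disj unfolding N_star_def by auto
  have "({i}, A) \<in> rtrancl_on ?W flips" if "A \<in> ?W" for A
  proof (rule reach_interval)
    have A: "A \<subseteq> I" "A \<inter> N = {i}" using that by (auto simp: N_star_def)
    show "finite A" using A(1) fin finite_subset by blast
    show "{i} \<subseteq> A" using A by auto
    fix C assume C: "{i} \<subseteq> C" "C \<subseteq> A"
    then have "C \<inter> N = {i}" using A i by auto
    moreover have less: "C \<inter> D = {}" if "A \<inter> D = {}" for D using C that by auto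
    have "A \<inter> X = {} \<and> A \<inter> Y = {} \<or> A \<inter> X = {} \<and> A \<inter> Z = {} \<or> A \<inter> Y = {} \<and> A \<inter> Z = {}"
      using \<open>A \<in> ?W\<close> unfolding N_star_def by simp
    then have "C \<inter> X = {} \<and> C \<inter> Y = {} \<or> C \<inter> X = {} \<and> C \<inter> Z = {} \<or> C \<inter> Y = {} \<and> C \<inter> Z = {}"
      using less by metis
    moreover have "C \<subseteq> I" using A C by (meson order_trans)
    ultimately show "C \<in> ?W" unfolding N_star_def by simp
  qed
  with root show "\<exists>R\<in>?W. \<forall>A\<in>?W. (R, A) \<in> rtrancl_on ?W flips" by blast
  fix T assume T: "T \<in> {X, Y, Z}"
  then have TN: "T \<inter> N = {}" "T \<subseteq> I" using disj by auto
  show "T \<notin> ?W" using TN unfolding N_star_def by simp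
  have "b \<in> (I - T) \<inter> N" using TN b by blast
  then have "(I - T) \<inter> N \<noteq> {i}" using b(2) by (metis singletonD)
  then show "I - T \<notin> ?W" unfolding N_star_def by simp
  have "insert i T \<in> ?W"
  proof -
    have "insert i T \<inter> N = {i}" using TN i by auto
    moreover have "i \<notin> X" "i \<notin> Y" "i \<notin> Z" using i disj by auto
    moreover have "T \<inter> X = {} \<and> T \<inter> Y = {} \<or> T \<inter> X = {} \<and> T \<inter> Z = {} \<or> T \<inter> Y = {} \<and> T \<inter> Z = {}"
      using T disj by blast
    moreover have "insert i T \<subseteq> I" using TN i by simp
    ultimately show ?thesis unfolding N_star_def by simp
  qed
  moreover have "(insert i T, T) \<in> flips" using TN i by (intro flips_insert) auto
  ultimately show "\<exists>A\<in>?W. (A, T) \<in> flips \<or> (A, I - T) \<in> flips" by blast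
qed

lemma X_star_cube_connector:
  assumes j: "j \<in> X" and b: "b \<in> N" and Y: "Y \<noteq> {}" and Z: "Z \<noteq> {}"
  shows "cube_connector I {X, Y, Z} (X_star b N X Y Z j)"
  unfolding cube_connector_def
proof (intro conjI ballI)
  let ?W = "X_star b N X Y Z j"
  let ?R = "N \<union> (X - {j})"
  have jn: "j \<notin> N" "j \<notin> Y" "j \<notin> Z" and bn: "b \<notin> X" "b \<notin> Y" "b \<notin> Z" using j b disj by auto
  have sub: "A \<subseteq> I" if "A \<in> ?W" for A using that by (auto simp: X_star_def)
  then show "?W \<subseteq> Pow I" by blast
  have R: "?R \<inter> X = X - {j}" "?R \<inter> Y = {}" "?R \<inter> Z = {}" using disj by auto
  then have root: "?R \<in> ?W" by (auto simp: X_star_def)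
  have up: "(?R, A) \<in> rtrancl_on ?W flips" if "A \<subseteq> ?R" "A \<inter> X = X - {j}" "b \<in> A" for A
  proof (rule reach_interval(2))
    show "finite ?R" using fin by blast
    fix C assume C: "A \<subseteq> C" "C \<subseteq> ?R"
    have "C \<inter> Y = {}" "C \<inter> Z = {}" using C R by blast+
    moreover have "C \<inter> X = X - {j}" using C R that(2) by blast
    moreover have "C \<subseteq> I" "b \<in> C" using C that(3) by blast+
    ultimately show "C \<in> ?W" by (simp add: X_star_def)
  qed (use that in blast)
  have "(?R, A) \<in> rtrancl_on ?W flips" if A: "A \<in> ?W" for A
  proof -
    consider "A \<inter> Y = {}" "A \<inter> Z = {}" "A \<inter> N = {}" | "A \<inter> Y = {}" "A \<inter> Z = {}" "b \<in> A"
      | "N \<subseteq> A" "A \<inter> Y = {} \<or> A \<inter> Z = {}"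
      using A unfolding X_star_def by blast
    then show ?thesis
    proof cases
      case 1
      moreover have "A \<inter> X = X - {j}" "A \<subseteq> I" using A by (simp_all add: X_star_def)
      ultimately have eq: "A = X - {j}" by blast
      have "(?R, insert b A) \<in> rtrancl_on ?W flips"
        by (rule up) (use eq b bn in auto)
      moreover have "(insert b A, A) \<in> flips" using eq bn by (intro flips_insert) auto
      ultimately show ?thesis using A by (rule rtrancl_on_into_rtrancl_on)
    next
      case 2
      have AX: "A \<inter> X = X - {j}" "A \<subseteq> I" using A by (simp_all add: X_star_def)
      then have "A \<subseteq> ?R" using 2 by blast
      then show ?thesis using AX 2 by (intro up)
    next
      case 3
      show ?thesis
      proof (rule reach_interval(1))
        show "finite A" using sub[OF A] fin finite_subset by blast
        show "?R \<subseteq> A" using A 3 by (auto simp: X_star_def)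
        have AX: "A \<inter> X = X - {j}" using A by (simp add: X_star_def)
        fix C assume C: "?R \<subseteq> C" "C \<subseteq> A"
        have "C \<inter> X = X - {j}" using C AX by blast
        moreover have "C \<inter> Y = {} \<or> C \<inter> Z = {}" using C 3 by blast
        moreover have "C \<subseteq> I" "N \<subseteq> C" using C sub[OF A] by blast+
        ultimately show "C \<in> ?W" by (simp add: X_star_def)
      qed
    qed
  qed
  with root show "\<exists>R\<in>?W. \<forall>A\<in>?W. (R, A) \<in> rtrancl_on ?W flips" by blast
  fix T assume T: "T \<in> {X, Y, Z}"
  have "X \<notin> ?W" using j by (auto simp: X_star_def)
  moreover have "Y \<notin> ?W" "Z \<notin> ?W"
    using b bn Y Z by (auto simp: X_star_def)
  moreover have "I - X \<notin> ?W" "I - Y \<notin> ?W" "I - Z \<notin> ?W"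
  proof -
    have not_mem: "A \<notin> ?W" if "j \<in> A \<or> A \<inter> Y \<noteq> {} \<and> A \<inter> Z \<noteq> {}" for A
      using that j by (auto simp: X_star_def)
    have "(I - X) \<inter> Y = Y" "(I - X) \<inter> Z = Z" "j \<in> I - Y" "j \<in> I - Z"
      using disj j jn by auto
    then show "I - X \<notin> ?W" "I - Y \<notin> ?W" "I - Z \<notin> ?W"
      using Y Z not_mem by metis+
  qed
  ultimately show "T \<notin> ?W" "I - T \<notin> ?W" using T by blast+
  have "(X - {j}) \<inter> N = {}" "(X - {j}) \<inter> Y = {}" "(X - {j}) \<inter> Z = {}" "(X - {j}) \<inter> X = X - {j}"
    "X - {j} \<subseteq> I" using disj by auto
  then have X: "X - {j} \<in> ?W" unfolding X_star_def by simp
  have "(I - Y - {j}) \<inter> X = X - {j}" "N \<subseteq> I - Y - {j}" "(I - Y - {j}) \<inter> Y = {}"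
    "(I - Z - {j}) \<inter> X = X - {j}" "N \<subseteq> I - Z - {j}" "(I - Z - {j}) \<inter> Z = {}"
    using disj jn by auto
  moreover have "I - Y - {j} \<subseteq> I" "I - Z - {j} \<subseteq> I" by auto
  ultimately have "I - Y - {j} \<in> ?W" "I - Z - {j} \<in> ?W"
    using X_star_topI by metis+
  moreover have "(I - Y - {j}, I - Y) \<in> flips" "(I - Z - {j}, I - Z) \<in> flips" "(X - {j}, X) \<in> flips"
    using j jn by (auto intro!: flips_remove)
  ultimately show "\<exists>A\<in>?W. (A, T) \<in> flips \<or> (A, I - T) \<in> flips" using T X by auto
qed

lemma spider_cube_connector:
  assumes k: "k \<in> Z" and b: "b \<in> N" and Y: "Y \<noteq> {}" and Z: "2 \<le> card Z" and \<C>: "disjoint_chains Z \<C>"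
  shows "cube_connector I {X, Y, Z} (spider b \<C> N X Y Z k)"
  unfolding cube_connector_def
proof (intro conjI ballI)
  let ?W = "spider b \<C> N X Y Z k"
  let ?R = "X \<union> (Z - {k})"
  have kn: "k \<notin> N" "k \<notin> X" "k \<notin> Y" and bn: "b \<notin> X" "b \<notin> Y" "b \<notin> Z" using k b disj by auto
  have sub: "A \<subseteq> I" if "A \<in> ?W" for A using that by (auto simp: spider_def)
  then show "?W \<subseteq> Pow I" by blast
  obtain k' where k': "k' \<in> Z" "k' \<noteq> k"
  proof -
    have "Z \<noteq> {k}" using Z by auto
    then show ?thesis using that k by blast
  qed
  have chain: "\<C> k \<subseteq> Pow Z - {{}, Z}" "\<exists>t\<in>Z. {t} \<in> \<C> k"
      "\<And>A. A \<in> \<C> k \<Longrightarrow> (Z - {k}, A) \<in> rtrancl_on (\<C> k) flips"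
    using \<C> k unfolding disjoint_chains_def by blast+
  have "?R \<inter> Y = {}" "?R \<inter> Z = Z - {k}" "?R \<inter> N = {}" "?R \<subseteq> I" using disj by auto
  then have root: "?R \<in> ?W" by (intro spider_bodyI disjI1)
  have lift: "X \<union> B \<in> ?W" if "B \<in> \<C> k" for B
  proof -
    have "B \<subseteq> Z" using that chain(1) by blast
    then have "(X \<union> B) \<inter> Z = B" "(X \<union> B) \<inter> Y = {}" "(X \<union> B) \<inter> N = {}" using disj by auto
    with that \<open>B \<subseteq> Z\<close> show ?thesis by (intro spider_armI) auto
  qed
  have lift_path: "(?R, X \<union> B) \<in> rtrancl_on ?W flips" if "(Z - {k}, B) \<in> rtrancl_on (\<C> k) flips" for B
    using that
  proof (induction rule: rtrancl_on_induct)
    case base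
    show ?case using root by (rule rtrancl_on_refl)
  next
    case (step B C)
    have BC: "B \<subseteq> Z" "C \<subseteq> Z" using step(3,4) chain(1) by auto
    then have "B \<inter> X = {}" "C \<inter> X = {}" using disj by auto
    then have "(X \<union> B, X \<union> C) \<in> flips"
    proof -
      obtain i where i: "i \<notin> B \<and> C = insert i B \<or> i \<notin> C \<and> B = insert i C"
        using step(2) by (auto simp: flips_def)
      then have "i \<notin> X" using \<open>B \<inter> X = {}\<close> \<open>C \<inter> X = {}\<close> by auto
      then show ?thesis using i flips_insert[of i "X \<union> B"] flips_insert[of i "X \<union> C"] by auto
    qed
    with step(5) show ?case by (rule rtrancl_on_into_rtrancl_on) (rule lift[OF step(4)])
  qed
  have "(?R, A) \<in> rtrancl_on ?W flips" if A: "A \<in> ?W" for A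
  proof -
    consider "A \<inter> N = {}" "A \<inter> Z = Z - {k}" | "A \<inter> Z = Z - {k}" "X \<subseteq> A" "b \<in> A"
      | "A \<inter> N = {}" "X \<subseteq> A" "A \<inter> Z \<in> \<C> k"
      using A unfolding spider_def by blast
    then show ?thesis
    proof cases
      case 1
      show ?thesis
      proof (rule reach_interval(2))
        show "finite ?R" using fin by blast
        have "A \<inter> Y = {}" "A \<subseteq> I" using A by (simp_all add: spider_def)
        then show "A \<subseteq> ?R" using 1 by blast
        fix C assume C: "A \<subseteq> C" "C \<subseteq> ?R"
        have "C \<inter> N = {}" "C \<inter> Y = {}" "C \<subseteq> I" using C(2) disj by auto
        moreover have "C \<inter> Z = Z - {k}" using C disj 1(2) by blast
        ultimately show "C \<in> ?W" by (intro spider_bodyI disjI1)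
      qed
    next
      case 2
      have Rb: "insert b ?R \<in> ?W"
      proof -
        have "insert b ?R \<inter> Z = Z - {k}" "insert b ?R \<inter> Y = {}" "insert b ?R \<subseteq> I" using b bn disj by auto
        then show ?thesis by (intro spider_bodyI) auto
      qed
      have "(?R, insert b ?R) \<in> flips" using bn by (intro flips_insert) auto
      then have "(?R, insert b ?R) \<in> rtrancl_on ?W flips"
        using root Rb by (meson rtrancl_on_into_rtrancl_on rtrancl_on_refl)
      moreover have "(insert b ?R, A) \<in> rtrancl_on ?W flips"
      proof (rule reach_interval(1))
        show "finite A" using sub[OF A] fin finite_subset by blast
        show "insert b ?R \<subseteq> A" using 2 by blast
        fix C assume C: "insert b ?R \<subseteq> C" "C \<subseteq> A"
        then have "C \<inter> Z = Z - {k}" using 2 by blast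
        moreover have "A \<inter> Y = {}" using A by (simp add: spider_def)
        then have "C \<inter> Y = {}" "C \<subseteq> I" using C sub[OF A] by blast+
        moreover have "X \<subseteq> C" "b \<in> C" using C by blast+
        ultimately show "C \<in> ?W" by (intro spider_bodyI disjI2 conjI)
      qed
      ultimately show ?thesis by (rule rtrancl_on_trans)
    next
      case 3
      moreover have "A \<inter> Y = {}" using A by (simp add: spider_def)
      ultimately have "A = X \<union> A \<inter> Z" using sub[OF A] by blast
      then show ?thesis using lift_path[OF chain(3)[OF 3(3)]] by simp
    qed
  qed
  with root show "\<exists>R\<in>?W. \<forall>A\<in>?W. (R, A) \<in> rtrancl_on ?W flips" by blast
  fix T assume T: "T \<in> {X, Y, Z}"
  have pr: "Z - {k} \<noteq> {}" "Z - {k} \<noteq> Z" "{} \<notin> \<C> k" "Z \<notin> \<C> k" using k k' chain(1) by auto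
  have not_mem: "A \<notin> ?W" if "A \<inter> Y \<noteq> {} \<or> A \<inter> Z = {} \<or> A \<inter> Z = Z" for A
    using that pr unfolding spider_def by auto
  have "X \<inter> Z = {}" "Y \<inter> Y = Y" "Z \<inter> Z = Z" "(I - X) \<inter> Y = Y" "(I - Y) \<inter> Z = Z" "(I - Z) \<inter> Y = Y"
    using disj by auto
  then have "X \<notin> ?W" "Y \<notin> ?W" "Z \<notin> ?W" "I - X \<notin> ?W" "I - Y \<notin> ?W" "I - Z \<notin> ?W"
    using Y not_mem by metis+
  then show "T \<notin> ?W" "I - T \<notin> ?W" using T by blast+
  obtain t where t: "t \<in> Z" "{t} \<in> \<C> k" using chain(2) by blast
  have x: "insert t X \<in> ?W" "(insert t X, X) \<in> flips"
    using lift[OF t(2)] t(1) disj by (auto intro!: flips_insert)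
  have z: "Z - {k} \<in> ?W" "(Z - {k}, Z) \<in> flips"
  proof -
    have "(Z - {k}) \<inter> N = {}" "(Z - {k}) \<inter> Y = {}" "(Z - {k}) \<inter> Z = Z - {k}" "Z - {k} \<subseteq> I"
      using disj by auto
    then show "Z - {k} \<in> ?W" by (intro spider_bodyI disjI1)
    show "(Z - {k}, Z) \<in> flips" using k by (rule flips_remove)
  qed
  have y: "I - Y - {k} \<in> ?W" "(I - Y - {k}, I - Y) \<in> flips"
  proof -
    have "(I - Y - {k}) \<inter> Z = Z - {k}" "b \<in> I - Y - {k}" "X \<subseteq> I - Y - {k}"
      using disj b kn bn k by auto
    moreover have "(I - Y - {k}) \<inter> Y = {}" "I - Y - {k} \<subseteq> I" by auto
    ultimately show "I - Y - {k} \<in> ?W" by (intro spider_bodyI disjI2 conjI)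
    show "(I - Y - {k}, I - Y) \<in> flips" using k kn by (intro flips_remove) auto
  qed
  show "\<exists>A\<in>?W. (A, T) \<in> flips \<or> (A, I - T) \<in> flips" using T x y z by auto
qed

end

section \<open>Disjointness of the connectors\<close>

lemma apart_sym:
  assumes "apart I \<V> \<W>" "\<W> \<subseteq> Pow I"
  shows "apart I \<W> \<V>"
  unfolding apart_def
proof
  fix B assume B: "B \<in> \<W>"
  then have "I - (I - B) = B" using assms(2) by auto
  then show "B \<notin> \<V> \<and> I - B \<notin> \<V>" using assms(1) B unfolding apart_def by metis
qed

definition connector_family :: "'a set \<Rightarrow> 'a set set \<Rightarrow> 'a set \<Rightarrow> ('a \<Rightarrow> 'a set set) \<Rightarrow> bool" where
  "connector_family I \<S> J W \<longleftrightarrow>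
     (\<forall>j\<in>J. cube_connector I \<S> (W j)) \<and> (\<forall>j\<in>J. \<forall>k\<in>J. j \<noteq> k \<longrightarrow> apart I (W j) (W k))"

lemma connector_family_Un:
  assumes W: "connector_family I \<S> J W" and V: "connector_family I \<S> K V"
    and apart: "\<And>j k. j \<in> J \<Longrightarrow> k \<in> K \<Longrightarrow> apart I (W j) (V k)"
  shows "connector_family I \<S> (J \<union> K) (\<lambda>j. if j \<in> J then W j else V j)"
proof -
  have rev: "apart I (V k) (W j)" if "j \<in> J" "k \<in> K" for j k
    by (rule apart_sym[OF apart[OF that]])
      (use V that in \<open>simp add: connector_family_def cube_connector_def\<close>)
  show ?thesis
    using W V apart rev unfolding connector_family_def by auto
qed

context four_parts
begin

lemma compl_Int:
  "(I - A) \<inter> N = N - A" "(I - A) \<inter> X = X - A" "(I - A) \<inter> Y = Y - A" "(I - A) \<inter> Z = Z - A"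
  by auto

text \<open>
  The part of a spider in \<open>Z\<close> is proper and nonempty and belongs to the chain of its direction.  This
  alone separates the spider of \<open>k\<close> from everything that has a trivial part in \<open>Z\<close> and, together
  with the empty part in \<open>Y\<close>, from all other spiders.
\<close>

lemma spider_Int_chain:
  assumes "disjoint_chains Z \<C>" "k \<in> Z" "A \<in> spider b \<C> N X Y Z k"
  shows "A \<inter> Z \<in> \<C> k" "A \<inter> Z \<noteq> {}" "A \<inter> Z \<noteq> Z" "A \<inter> Y = {}"
proof -
  have C: "\<C> k \<subseteq> Pow Z - {{}, Z}" "Z - {k} \<in> \<C> k"
    using assms(1,2) by (auto simp: disjoint_chains_def)
  show *: "A \<inter> Z \<in> \<C> k" using assms(3) C(2) by (auto simp: spider_def)
  then show "A \<inter> Z \<noteq> {}" "A \<inter> Z \<noteq> Z" using C(1) by auto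
  show "A \<inter> Y = {}" using assms(3) by (simp add: spider_def)
qed

lemma N_star_apart:
  assumes "b \<in> N" "b \<noteq> i" "b \<noteq> j" "i \<noteq> j"
  shows "apart I (N_star N X Y Z i) (N_star N X Y Z j)"
  unfolding apart_def
proof (intro ballI conjI)
  fix A assume "A \<in> N_star N X Y Z i"
  then have A: "A \<inter> N = {i}" by (simp add: N_star_def)
  then show "A \<notin> N_star N X Y Z j" using assms(4) by (simp add: N_star_def)
  have "b \<in> N - A" using A assms by blast
  then have "N - A \<noteq> {j}" using assms(3) by blast
  then show "I - A \<notin> N_star N X Y Z j" unfolding N_star_def mem_Collect_eq compl_Int by blast
qed

text \<open>
  Every other kind of connector violates one of these properties of a star of \<open>N\<close>, and so do the
  complements of its members.
\<close>

lemma N_star_cases: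
  assumes "A \<in> N_star N X Y Z i" "b \<in> N" "b \<noteq> i"
  shows "A \<inter> N \<noteq> {}" "b \<notin> A" "\<not> N \<subseteq> I - A" "Y - A = {} \<Longrightarrow> Y \<noteq> {} \<Longrightarrow> A \<inter> Z = {}"
proof -
  have A: "A \<inter> N = {i}" using assms(1) by (simp add: N_star_def)
  then show "A \<inter> N \<noteq> {}" "b \<notin> A" "\<not> N \<subseteq> I - A" using assms(2,3) by auto
  assume "Y - A = {}" "Y \<noteq> {}"
  then have "A \<inter> Y \<noteq> {}" by blast
  then show "A \<inter> Z = {}" using assms(1) by (auto simp: N_star_def)
qed

lemma N_star_X_star_apart:
  assumes b: "b \<in> N" "b \<noteq> i" and Y: "Y \<noteq> {}" and Z: "Z \<noteq> {}"
  shows "apart I (N_star N X Y Z i) (X_star b N X Y Z j)"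
  unfolding apart_def
proof (intro ballI conjI)
  fix A assume "A \<in> N_star N X Y Z i"
  note A = N_star_cases[OF this b]
  show "A \<notin> X_star b N X Y Z j" using A(1,2) b(1) by (auto simp: X_star_def)
  have "\<not> (Y - A = {} \<and> Z - A = {})" using A(4) Y Z by blast
  then show "I - A \<notin> X_star b N X Y Z j"
    using A(3) unfolding X_star_def mem_Collect_eq compl_Int by blast
qed

lemma N_star_spider_apart:
  assumes b: "b \<in> N" "b \<noteq> i" and Y: "Y \<noteq> {}" and \<C>: "disjoint_chains Z \<C>" and k: "k \<in> Z"
  shows "apart I (N_star N X Y Z i) (spider b \<C> N X Y Z k)"
  unfolding apart_def
proof (intro ballI conjI)
  fix A assume "A \<in> N_star N X Y Z i"
  note A = N_star_cases[OF this b]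
  show "A \<notin> spider b \<C> N X Y Z k" using A(1,2) by (auto simp: spider_def)
  show "I - A \<notin> spider b \<C> N X Y Z k"
  proof
    assume "I - A \<in> spider b \<C> N X Y Z k"
    note B = spider_Int_chain[OF \<C> k this]
    have "Y - A = {}" using B(4) by (simp only: compl_Int)
    then have "A \<inter> Z = {}" using A(4) Y by blast
    then have "(I - A) \<inter> Z = Z" unfolding compl_Int by blast
    then show False using B(3) by blast
  qed
qed

lemma X_star_apart:
  assumes b: "b \<in> N" and Y: "Y \<noteq> {}" and Z: "Z \<noteq> {}" and jk: "j \<in> X" "k \<in> X" "j \<noteq> k"
  shows "apart I (X_star b N X Y Z j) (X_star b N X Y Z k)"
  unfolding apart_def
proof (intro ballI conjI)
  fix A assume A: "A \<in> X_star b N X Y Z j"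
  then have "A \<inter> X = X - {j}" by (simp add: X_star_def)
  then have "k \<in> A" using jk by blast
  then show "A \<notin> X_star b N X Y Z k" using jk by (auto simp: X_star_def)
  have 1: "A \<inter> Y = {} \<and> A \<inter> Z = {} \<or> N \<subseteq> A \<and> (A \<inter> Y = {} \<or> A \<inter> Z = {})"
    using A by (auto simp: X_star_def)
  show "I - A \<notin> X_star b N X Y Z k"
  proof
    assume B: "I - A \<in> X_star b N X Y Z k"
    have "Y - A = {} \<and> Z - A = {} \<or> N \<subseteq> I - A \<and> (Y - A = {} \<or> Z - A = {})"
      using B unfolding X_star_def mem_Collect_eq compl_Int by blast
    then show False using 1 b Y Z by blast
  qed
qed

lemma X_star_spider_apart:
  assumes b: "b \<in> N" and Y: "Y \<noteq> {}" and \<C>: "disjoint_chains Z \<C>" and k: "k \<in> Z" and j: "j \<in> X"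
  shows "apart I (X_star b N X Y Z j) (spider b \<C> N X Y Z k)"
  unfolding apart_def
proof (intro ballI conjI)
  fix A assume A: "A \<in> X_star b N X Y Z j"
  have AX: "j \<notin> A" using A j by (auto simp: X_star_def)
  show "A \<notin> spider b \<C> N X Y Z k"
  proof
    assume B: "A \<in> spider b \<C> N X Y Z k"
    have "A \<inter> N = {}" using B AX j by (auto simp: spider_def)
    then have "\<not> N \<subseteq> A" using b by blast
    then have "A \<inter> Z = {}" using A by (simp add: X_star_def)
    then show False using spider_Int_chain(2)[OF \<C> k B] by blast
  qed
  show "I - A \<notin> spider b \<C> N X Y Z k"
  proof
    assume "I - A \<in> spider b \<C> N X Y Z k"
    note B = spider_Int_chain[OF \<C> k this]
    have "Y - A = {}" using B(4) by (simp only: compl_Int)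
    then have "A \<inter> Y \<noteq> {}" using Y by blast
    then have "A \<inter> Z = {}" using A by (auto simp: X_star_def)
    then have "(I - A) \<inter> Z = Z" unfolding compl_Int by blast
    then show False using B(3) by blast
  qed
qed

lemma spider_apart:
  assumes Y: "Y \<noteq> {}" and \<C>: "disjoint_chains Z \<C>" and kl: "k \<in> Z" "l \<in> Z" "k \<noteq> l"
  shows "apart I (spider b \<C> N X Y Z k) (spider b \<C> N X Y Z l)"
  unfolding apart_def
proof (intro ballI conjI)
  fix A assume A: "A \<in> spider b \<C> N X Y Z k"
  note A' = spider_Int_chain[OF \<C> kl(1) A]
  have "\<C> k \<inter> \<C> l = {}" using \<C> kl unfolding disjoint_chains_def by metis
  then show "A \<notin> spider b \<C> N X Y Z l"
    using A'(1) spider_Int_chain(1)[OF \<C> kl(2)] by blast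
  show "I - A \<notin> spider b \<C> N X Y Z l"
  proof
    assume "I - A \<in> spider b \<C> N X Y Z l"
    note B = spider_Int_chain[OF \<C> kl(2) this]
    have "Y - A = {}" using B(4) by (simp only: compl_Int)
    then show False using A'(4) Y by blast
  qed
qed

lemma spider_swap_apart:
  assumes \<C>: "disjoint_chains Z \<C>" "k \<in> Z" and \<D>: "disjoint_chains Y \<D>" "l \<in> Y"
  shows "apart I (spider b \<C> N X Y Z k) (spider b \<D> N X Z Y l)"
  unfolding apart_def
proof (intro ballI conjI)
  interpret swapped: four_parts N X Z Y by (rule swap_YZ)
  fix A assume A: "A \<in> spider b \<C> N X Y Z k"
  note A' = spider_Int_chain[OF \<C> A]
  show "A \<notin> spider b \<D> N X Z Y l"
    using A'(2) swapped.spider_Int_chain(4)[OF \<D>] by blast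
  show "I - A \<notin> spider b \<D> N X Z Y l"
  proof
    assume "I - A \<in> spider b \<D> N X Z Y l"
    note B = swapped.spider_Int_chain[OF \<D> this]
    have "Z - A = {}" using B(4) by (simp only: compl_Int)
    then show False using A'(3) by blast
  qed
qed

lemma spider_family:
  assumes "b \<in> N" "Y \<noteq> {}" "2 \<le> card Z" "disjoint_chains Z \<C>"
  shows "connector_family I {X, Y, Z} Z (spider b \<C> N X Y Z)"
  using assms spider_cube_connector spider_apart unfolding connector_family_def by simp

text \<open>
  The direction \<open>b\<close> carries no connector: its edges are used by the stars of \<open>X\<close> and by the spiders
  to pass through \<open>N\<close> without meeting the stars of \<open>N\<close>.
\<close>

lemma family_two_large:
  assumes b: "b \<in> N" and Y: "2 \<le> card Y" and Z: "2 \<le> card Z"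
  shows "\<exists>W. connector_family I {X, Y, Z} (I - {b}) W"
proof -
  interpret swapped: four_parts N X Z Y by (rule swap_YZ)
  obtain \<C> where \<C>: "disjoint_chains Z \<C>" using ex_disjoint_chains[OF fin(4) Z] by blast
  obtain \<D> where \<D>: "disjoint_chains Y \<D>" using ex_disjoint_chains[OF fin(3) Y] by blast
  have ne: "Y \<noteq> {}" "Z \<noteq> {}" using Y Z by auto
  have swap: "N \<union> X \<union> Z \<union> Y = I" "{X, Z, Y} = {X, Y, Z}" by auto
  let ?S = "{X, Y, Z}"
  have n: "connector_family I ?S (N - {b}) (N_star N X Y Z)"
    using N_star_cube_connector N_star_apart b unfolding connector_family_def by auto
  have x: "connector_family I ?S X (X_star b N X Y Z)"
    using X_star_cube_connector X_star_apart b ne unfolding connector_family_def by auto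
  have z: "connector_family I ?S Z (spider b \<C> N X Y Z)"
    by (rule spider_family[OF b ne(1) Z \<C>])
  have y: "connector_family I ?S Y (spider b \<D> N X Z Y)"
    using swapped.spider_family[OF b ne(2) Y \<D>] unfolding swap .
  have N_swap: "N_star N X Z Y = N_star N X Y Z" and X_swap: "X_star b N X Z Y = X_star b N X Y Z"
    by (auto simp: N_star_def X_star_def fun_eq_iff)
  have ny: "apart I (N_star N X Y Z i) (spider b \<D> N X Z Y l)" if "b \<noteq> i" "l \<in> Y" for i l
    using swapped.N_star_spider_apart[OF b that(1) ne(2) \<D> that(2)] unfolding swap N_swap .
  have xy: "apart I (X_star b N X Y Z j) (spider b \<D> N X Z Y l)" if "j \<in> X" "l \<in> Y" for j l
    using swapped.X_star_spider_apart[OF b ne(2) \<D> that(2,1)] unfolding swap X_swap .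
  have nx: "apart I (N_star N X Y Z i) (X_star b N X Y Z j)" if "b \<noteq> i" for i j
    using N_star_X_star_apart b that ne by blast
  have nz: "apart I (N_star N X Y Z i) (spider b \<C> N X Y Z k)" if "b \<noteq> i" "k \<in> Z" for i k
    using N_star_spider_apart b that ne \<C> by blast
  have xz: "apart I (X_star b N X Y Z j) (spider b \<C> N X Y Z k)" if "j \<in> X" "k \<in> Z" for j k
    using X_star_spider_apart b that ne \<C> by blast
  have zy: "apart I (spider b \<C> N X Y Z k) (spider b \<D> N X Z Y l)" if "k \<in> Z" "l \<in> Y" for k l
    using spider_swap_apart \<C> \<D> that by blast
  have "\<exists>W. connector_family I ?S ((N - {b}) \<union> X \<union> (Z \<union> Y)) W"
    by (rule exI, rule connector_family_Un[OF connector_family_Un[OF n x] connector_family_Un[OF z y]])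
      (use nx nz ny xz xy zy in \<open>auto split: if_splits\<close>)
  moreover have "(N - {b}) \<union> X \<union> (Z \<union> Y) = I - {b}" using b disj by auto
  ultimately show ?thesis by simp
qed

end

section \<open>Small blocks\<close>

lemma ball_tripleI: "P x \<Longrightarrow> P y \<Longrightarrow> P z \<Longrightarrow> \<forall>t\<in>{x, y, z}. P t"
  by simp

context four_parts
begin

lemma cube_connector_singleton:
  assumes "A \<subseteq> I" "\<forall>T\<in>\<S>. T \<noteq> A \<and> I - T \<noteq> A \<and> ((A, T) \<in> flips \<or> (A, I - T) \<in> flips)"
  shows "cube_connector I \<S> {A}"
  using assms unfolding cube_connector_def by auto

text \<open>
  A spider for \<open>q\<close> would need a second element of \<open>Y\<close>.  Instead, the star of \<open>p\<close> is split: it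
  contains the vertex \<open>{b} \<union> Z\<close>, which is a common neighbour of \<open>x\<close>, \<open>y\<close> and \<open>z\<close>, and the path \<open>{}\<close>,
  \<open>{b}\<close>, \<open>{b, q}\<close>, which starts at a common neighbour of \<open>x\<close> and \<open>y\<close> and ends at a neighbour of \<open>z\<close>.
\<close>

lemma family_one_large:
  assumes N: "N = {b}" and X: "X = {p}" and Y: "Y = {q}" and Z: "2 \<le> card Z"
  shows "\<exists>W. connector_family I {X, Y, Z} (I - {b}) W"
proof -
  obtain \<C> where \<C>: "disjoint_chains Z \<C>" using ex_disjoint_chains[OF fin(4) Z] by blast
  have ne: "b \<in> N" "Y \<noteq> {}" "Z \<noteq> {}" using N Y Z by auto
  have dist: "b \<noteq> p" "b \<noteq> q" "p \<noteq> q" "b \<notin> Z" "p \<notin> Z" "q \<notin> Z" using disj N X Y by auto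
  have z: "connector_family I {X, Y, Z} Z (spider b \<C> N X Y Z)"
    by (rule spider_family[OF ne(1,2) Z \<C>])
  let ?P = "{{}, {b}, {b, q}}" and ?M = "{insert b Z}"
  have compl: "I - X = insert b (insert q Z)" "I - Y = insert b (insert p Z)" "I - Z = {b, p, q}"
    using N X Y dist by auto
  have P: "cube_connector I {X, Y, Z} ?P"
    unfolding cube_connector_def
  proof (intro conjI)
    show "?P \<subseteq> Pow I" using N Y by auto
    have "({b}, {}) \<in> flips" "({b}, {b, q}) \<in> flips"
      using flips_insert(2)[of b "{}"] flips_insert(1)[of q "{b}"] dist by (auto simp: insert_commute)
    then have "(({b}, A) \<in> rtrancl_on ?P flips)" if "A \<in> ?P" for A
      using that by (auto intro: rtrancl_on_into_rtrancl_on[OF rtrancl_on_refl])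
    then show "\<exists>R\<in>?P. \<forall>A\<in>?P. (R, A) \<in> rtrancl_on ?P flips" by blast
    have fl: "({}, X) \<in> flips" "({}, Y) \<in> flips" "({b, q}, I - Z) \<in> flips"
      using flips_insert(1)[of p "{}"] flips_insert(1)[of q "{}"] flips_insert(1)[of p "{b, q}"] dist
      unfolding compl unfolding X Y by (auto simp: insert_commute)
    have "X \<notin> ?P" "Y \<notin> ?P" "Z \<notin> ?P"
      unfolding X Y using dist ne(3) by auto
    moreover have "I - X \<notin> ?P" "I - Y \<notin> ?P" "I - Z \<notin> ?P"
      unfolding compl using dist ne(3) by auto
    moreover have "\<exists>A\<in>?P. (A, X) \<in> flips \<or> (A, I - X) \<in> flips" using fl(1) by blast
    moreover have "\<exists>A\<in>?P. (A, Y) \<in> flips \<or> (A, I - Y) \<in> flips" using fl(2) by blast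
    moreover have "\<exists>A\<in>?P. (A, Z) \<in> flips \<or> (A, I - Z) \<in> flips" using fl(3) by blast
    ultimately show "\<forall>T\<in>{X, Y, Z}. T \<notin> ?P \<and> I - T \<notin> ?P \<and> (\<exists>A\<in>?P. (A, T) \<in> flips \<or> (A, I - T) \<in> flips)"
      by (intro ball_tripleI conjI)
  qed
  have M: "cube_connector I {X, Y, Z} ?M"
  proof (rule cube_connector_singleton)
    show "insert b Z \<subseteq> I" using N by auto
    have "(insert b Z, Z) \<in> flips" "(insert b Z, I - X) \<in> flips" "(insert b Z, I - Y) \<in> flips"
      using flips_insert(2)[of b Z] flips_insert(1)[of q "insert b Z"] flips_insert(1)[of p "insert b Z"] dist
      unfolding compl by (auto simp: insert_commute)
    moreover have "X \<noteq> insert b Z" "Y \<noteq> insert b Z" "Z \<noteq> insert b Z"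
      "I - X \<noteq> insert b Z" "I - Y \<noteq> insert b Z" "I - Z \<noteq> insert b Z"
      unfolding compl using X Y dist ne(3) by auto
    ultimately show "\<forall>T\<in>{X, Y, Z}. T \<noteq> insert b Z \<and> I - T \<noteq> insert b Z \<and> ((insert b Z, T) \<in> flips \<or> (insert b Z, I - T) \<in> flips)"
      by (intro ball_tripleI) (simp_all only: simp_thms)
  qed
  have PM: "apart I ?P ?M"
  proof -
    have "Z \<noteq> {}" "Z \<noteq> {q}" "b \<noteq> p" using ne dist by auto
    moreover have "p \<in> I" "p \<notin> insert b Z" using X dist by auto
    ultimately show ?thesis using dist unfolding apart_def by auto
  qed
  let ?V = "\<lambda>i. if i = p then ?P else ?M"
  have pq: "connector_family I {X, Y, Z} {p, q} ?V"
    using P M PM apart_sym[OF PM] dist N unfolding connector_family_def by auto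
  have zpq: "apart I (spider b \<C> N X Y Z k) (?V i)" if k: "k \<in> Z" for k i
    unfolding apart_def
  proof (intro ballI conjI)
    fix A assume A: "A \<in> spider b \<C> N X Y Z k"
    note A' = spider_Int_chain[OF \<C> k A]
    have ZA: "(I - A) \<inter> Z \<noteq> {}" "q \<in> I - A" using A'(3,4) Y unfolding compl_Int by auto
    show "A \<notin> ?V i" using A'(2,3) dist by auto
    have "I - A \<noteq> insert b Z" using ZA(2) dist by auto
    moreover have "I - A \<notin> ?P" using ZA(1) dist by auto
    ultimately show "I - A \<notin> ?V i" by simp
  qed
  have "\<exists>W. connector_family I {X, Y, Z} (Z \<union> {p, q}) W"
    by (rule exI, rule connector_family_Un[OF z pq]) (rule zpq)
  moreover have "Z \<union> {p, q} = I - {b}" using N X Y dist by auto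
  ultimately show ?thesis by simp
qed

text \<open>
  Here the graph is \<open>K\<^sub>4\<^sub>,\<^sub>4\<close> and the three vertices lie on the same side, so every vertex of the other
  side is a connector by itself.
\<close>

lemma family_all_singletons:
  assumes N: "N = {b}" and X: "X = {p}" and Y: "Y = {q}" and Z: "Z = {r}"
  shows "\<exists>W. connector_family I {X, Y, Z} (I - {b}) W"
proof -
  have dist: "b \<noteq> p" "b \<noteq> q" "p \<noteq> q" "b \<noteq> r" "p \<noteq> r" "q \<noteq> r" using disj N X Y Z by auto
  have compl: "I - X = {b, q, r}" "I - Y = {b, p, r}" "I - Z = {b, p, q}"
    using N X Y Z dist by auto
  let ?W = "\<lambda>i. if i = p then {{}} else if i = q then {{b, p}} else {{b, r}}"
  have 1: "cube_connector I {X, Y, Z} {{}}"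
  proof (rule cube_connector_singleton)
    have "({}, X) \<in> flips" "({}, Y) \<in> flips" "({}, Z) \<in> flips"
      unfolding X Y Z by (rule flips_insert, simp)+
    moreover have "X \<noteq> {}" "Y \<noteq> {}" "Z \<noteq> {}" unfolding X Y Z by simp_all
    moreover have "I - X \<noteq> {}" "I - Y \<noteq> {}" "I - Z \<noteq> {}" unfolding compl by simp_all
    ultimately show "\<forall>T\<in>{X, Y, Z}. T \<noteq> {} \<and> I - T \<noteq> {} \<and> (({}, T) \<in> flips \<or> ({}, I - T) \<in> flips)"
      by (intro ball_tripleI) (simp_all only: simp_thms)
  qed simp
  have 2: "cube_connector I {X, Y, Z} {{b, p}}"
  proof (rule cube_connector_singleton)
    have "({b, p}, X) \<in> flips" "({b, p}, I - Y) \<in> flips" "({b, p}, I - Z) \<in> flips"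
      using flips_insert(2)[of b "{p}"] flips_insert(1)[of r "{b, p}"] flips_insert(1)[of q "{b, p}"] dist
      unfolding compl unfolding X by (auto simp: insert_commute)
    moreover have "X \<noteq> {b, p}" "Y \<noteq> {b, p}" "Z \<noteq> {b, p}" "I - X \<noteq> {b, p}" "I - Y \<noteq> {b, p}" "I - Z \<noteq> {b, p}"
      unfolding compl using X Y Z dist by auto
    ultimately show "\<forall>T\<in>{X, Y, Z}. T \<noteq> {b, p} \<and> I - T \<noteq> {b, p} \<and> (({b, p}, T) \<in> flips \<or> ({b, p}, I - T) \<in> flips)"
      by (intro ball_tripleI) (simp_all only: simp_thms)
  qed (use N X in auto)
  have 3: "cube_connector I {X, Y, Z} {{b, r}}"
  proof (rule cube_connector_singleton)
    have "({b, r}, Z) \<in> flips" "({b, r}, I - X) \<in> flips" "({b, r}, I - Y) \<in> flips"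
      using flips_insert(2)[of b "{r}"] flips_insert(1)[of q "{b, r}"] flips_insert(1)[of p "{b, r}"] dist
      unfolding compl unfolding Z by (auto simp: insert_commute)
    moreover have "X \<noteq> {b, r}" "Y \<noteq> {b, r}" "Z \<noteq> {b, r}" "I - X \<noteq> {b, r}" "I - Y \<noteq> {b, r}" "I - Z \<noteq> {b, r}"
      unfolding compl using X Y Z dist by auto
    ultimately show "\<forall>T\<in>{X, Y, Z}. T \<noteq> {b, r} \<and> I - T \<noteq> {b, r} \<and> (({b, r}, T) \<in> flips \<or> ({b, r}, I - T) \<in> flips)"
      by (intro ball_tripleI) (simp_all only: simp_thms)
  qed (use N Z in auto)
  have I: "I = {b, p, q, r}" using N X Y Z by auto
  have "I - {b, p} = {q, r}" "I - {b, r} = {p, q}" unfolding I using dist by auto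
  moreover have "{q, r} \<noteq> {b, r}" "{p, q} \<noteq> {b, p}" "{b, p} \<noteq> {b, r}" "I \<noteq> {b, p}" "I \<noteq> {b, r}"
    unfolding I using dist by auto
  ultimately have ap: "apart I {{}} {{b, p}}" "apart I {{}} {{b, r}}" "apart I {{b, p}} {{b, r}}"
      "apart I {{b, p}} {{}}" "apart I {{b, r}} {{}}" "apart I {{b, r}} {{b, p}}"
    unfolding apart_def by simp_all
  have "connector_family I {X, Y, Z} {p, q, r} ?W"
    unfolding connector_family_def
  proof (intro conjI ball_tripleI impI)
  qed (use 1 2 3 ap dist in simp_all)
  moreover have "I - {b} = {p, q, r}" unfolding I using dist by auto
  ultimately show ?thesis by (intro exI[of _ ?W]) (simp only:)
qed

text \<open>
  Here the graph is \<open>K\<^sub>4\<close> and the fourth vertex is the only one available.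
\<close>

lemma family_K4:
  assumes N: "N = {b}" and X: "X = {}" and Y: "Y = {q}" and Z: "Z = {r}"
  shows "\<exists>W. connector_family I {X, Y, Z} Z W"
proof -
  have dist: "b \<noteq> q" "b \<noteq> r" "q \<noteq> r" using disj N X Y Z by auto
  have compl: "I - X = {b, q, r}" "I - Y = {b, r}" "I - Z = {b, q}"
    using N X Y Z dist by auto
  have "cube_connector I {X, Y, Z} {{q, r}}"
  proof (rule cube_connector_singleton)
    have "({q, r}, Y) \<in> flips" "({q, r}, Z) \<in> flips" "({q, r}, I - X) \<in> flips"
      using flips_insert(2)[of r "{q}"] flips_insert(2)[of q "{r}"] flips_insert(1)[of b "{q, r}"] dist
      unfolding compl unfolding Y Z by (auto simp: insert_commute)
    moreover have "X \<noteq> {q, r}" "Y \<noteq> {q, r}" "Z \<noteq> {q, r}" "I - X \<noteq> {q, r}" "I - Y \<noteq> {q, r}" "I - Z \<noteq> {q, r}"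
      unfolding compl using X Y Z dist by auto
    ultimately show "\<forall>T\<in>{X, Y, Z}. T \<noteq> {q, r} \<and> I - T \<noteq> {q, r} \<and> (({q, r}, T) \<in> flips \<or> ({q, r}, I - T) \<in> flips)"
      by (intro ball_tripleI) (simp_all only: simp_thms)
  qed (use Y Z in auto)
  then show ?thesis using Z unfolding connector_family_def by auto
qed

lemma kappa_set_family:
  assumes G: "pair_graph G" and \<phi>: "folded_coordinates G I \<phi>" and J: "finite J"
    and W: "connector_family I {X, Y, Z} J W"
  shows "card J \<le> kappa_set G {\<phi> X, \<phi> Y, \<phi> Z}"
    and "S_tree G {\<phi> X, \<phi> Y, \<phi> Z} T0 \<Longrightarrow> pverts T0 = {\<phi> X, \<phi> Y, \<phi> Z} \<Longrightarrow>
      Suc (card J) \<le> kappa_set G {\<phi> X, \<phi> Y, \<phi> Z}"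
proof -
  let ?S = "{\<phi> X, \<phi> Y, \<phi> Z}"
  have S: "?S \<subseteq> pverts G" using folded_coordinatesD(1)[OF \<phi>] by auto
  have sub: "W j \<subseteq> Pow I" if "j \<in> J" for j
    using W that by (simp add: connector_family_def cube_connector_def)
  have conn: "connector G ?S (\<phi> ` W j)" if "j \<in> J" for j
  proof -
    have "connector G (\<phi> ` {X, Y, Z}) (\<phi> ` W j)"
      by (rule cube_connector_image[OF \<phi>]) (use W that in \<open>auto simp: connector_family_def\<close>)
    then show ?thesis by simp
  qed
  have dis: "\<phi> ` W j \<inter> \<phi> ` W k = {}" if "j \<in> J" "k \<in> J" "j \<noteq> k" for j k
    by (rule apart_image_disjoint[OF \<phi> sub sub]) (use W that in \<open>auto simp: connector_family_def\<close>)
  show "card J \<le> kappa_set G ?S"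
    by (rule kappa_set_connectors(1)[OF G S J conn dis])
  show "Suc (card J) \<le> kappa_set G ?S" if "S_tree G ?S T0" "pverts T0 = ?S"
    by (rule kappa_set_connectors(2)[OF G S J conn dis that])
qed

text \<open>
  If \<open>X\<close> is empty and \<open>N\<close> and \<open>Y\<close> are singletons, then \<open>y\<close> is adjacent to \<open>x\<close> and, across the
  single element of \<open>N\<close>, to \<open>z\<close>.  The path \<open>x\<close>, \<open>y\<close>, \<open>z\<close> then makes up for the missing connector.
\<close>

lemma kappa_set_sorted:
  assumes G: "pair_graph G" and \<phi>: "folded_coordinates G I \<phi>"
    and sorted: "card X \<le> card N" "card N \<le> card Y" "card Y \<le> card Z" and N: "N \<noteq> {}"
    and ne: "\<phi> X \<noteq> \<phi> Z"
  shows "card I \<le> Suc (kappa_set G {\<phi> X, \<phi> Y, \<phi> Z})"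
proof -
  have finI: "finite I" using fin by simp
  have N1: "1 \<le> card N" using N fin by (simp add: Suc_leI card_gt_0_iff)
  have whole: ?thesis if "connector_family I {X, Y, Z} (I - {b}) W" "b \<in> N" for b W
    using kappa_set_family(1)[OF G \<phi> _ that(1)] finI that(2) by (simp add: card_Diff_singleton)
  show ?thesis
  proof (cases "2 \<le> card Y")
    case True
    obtain b where "b \<in> N" using N by blast
    moreover have "2 \<le> card Z" using True sorted by simp
    ultimately show ?thesis using family_two_large True whole by blast
  next
    case False
    then have "card N = 1" "card Y = 1" using N1 sorted by linarith+
    then obtain b q where bq: "N = {b}" "Y = {q}" by (auto simp: card_1_singleton_iff)
    consider (X1) p where "X = {p}" | (X0) "X = {}"
      using sorted(1) \<open>card N = 1\<close> fin(2) by (metis card_0_eq card_1_singletonE le_neq_implies_less less_one)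
    note Xcases = this
    consider (Z2) "2 \<le> card Z" | (Z1) r where "Z = {r}"
      using sorted(3) \<open>card Y = 1\<close> by (metis card_1_singletonE le_antisym not_less_eq_eq numeral_2_eq_2 One_nat_def)
    note Zcases = this
    show ?thesis
    proof (cases rule: Xcases)
      case X1
      show ?thesis
        by (cases rule: Zcases)
          (use family_one_large[OF bq(1) X1 bq(2)] family_all_singletons[OF bq(1) X1 bq(2)] whole bq in blast)+
    next
      case X0
      have "\<exists>W. connector_family I {X, Y, Z} Z W"
      proof (cases rule: Zcases)
        case Z2
        then show ?thesis using spider_family[of b] ex_disjoint_chains[OF fin(4) Z2] bq by blast
      next
        case Z1
        then show ?thesis using family_K4 bq X0 by blast
      qed
      then obtain W where W: "connector_family I {X, Y, Z} Z W" ..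
      have IZ: "I - Y = insert b Z" and dist: "b \<notin> Z" "b \<noteq> q" using bq X0 disj by auto
      have "(\<phi> Y, \<phi> X) \<in> parcs G"
        by (rule folded_coordinatesD(4)[OF \<phi>]) (use bq X0 flips_insert(2)[of q "{}"] in auto)
      \<comment> \<open>The complement of \<open>Y\<close> differs from \<open>Z\<close> by the single element of \<open>N\<close>.\<close>
      moreover have "(\<phi> (I - Y), \<phi> Z) \<in> parcs G"
        by (rule folded_coordinatesD(4)[OF \<phi>]) (use IZ flips_insert(2)[OF dist(1)] in auto)
      moreover have "\<phi> (I - Y) = \<phi> Y" by (rule folded_coordinatesD(2)[OF \<phi>]) blast
      ultimately have "(\<phi> Y, \<phi> X) \<in> parcs G" "(\<phi> Y, \<phi> Z) \<in> parcs G" by (simp_all only:)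
      then obtain T0 where "S_tree G {\<phi> X, \<phi> Y, \<phi> Z} T0" "pverts T0 = {\<phi> X, \<phi> Y, \<phi> Z}"
        using S_tree_path[OF G _ _ ne] by metis
      then have "Suc (card Z) \<le> kappa_set G {\<phi> X, \<phi> Y, \<phi> Z}"
        by (rule kappa_set_family(2)[OF G \<phi> fin(4) W])
      moreover have "card I = Suc (Suc (card Z))"
      proof -
        have "I = insert b (insert q Z)" "q \<notin> Z" using bq X0 disj by auto
        then show ?thesis using dist fin(4) by simp
      qed
      ultimately show ?thesis by simp
    qed
  qed
qed

end

section \<open>Permuting the four blocks\<close>

text \<open>
  Adjacent transpositions suffice to sort four blocks by size.
\<close>

lemma sort_four:
  fixes f :: "'b \<Rightarrow> nat"
  assumes sorted: "\<And>a b c d. f a \<le> f b \<Longrightarrow> f b \<le> f c \<Longrightarrow> f c \<le> f d \<Longrightarrow> R a b c d"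
    and t1: "\<And>a b c d. R a b c d \<Longrightarrow> R b a c d"
    and t2: "\<And>a b c d. R a b c d \<Longrightarrow> R a c b d"
    and t3: "\<And>a b c d. R a b c d \<Longrightarrow> R a b d c"
  shows "R a b c d"
proof -
  have 3: "R a b c d" if "f a \<le> f b" "f b \<le> f c" for a b c d
  proof -
    consider "f c \<le> f d" | "f b \<le> f d" "f d \<le> f c" | "f a \<le> f d" "f d \<le> f b" | "f d \<le> f a"
      by linarith
    then show ?thesis
    proof cases
      case 1 show ?thesis using sorted[OF that 1] .
    next
      case 2 show ?thesis using t3[OF sorted[OF that(1) 2]] .
    next
      case 3 show ?thesis using t3[OF t2[OF sorted[OF 3 that(2)]]] .
    next
      case 4 show ?thesis using t3[OF t2[OF t1[OF sorted[OF 4 that]]]] .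
    qed
  qed
  have 2: "R a b c d" if "f a \<le> f b" for a b c d
  proof -
    consider "f b \<le> f c" | "f a \<le> f c" "f c \<le> f b" | "f c \<le> f a"
      by linarith
    then show ?thesis
    proof cases
      case 1 show ?thesis using 3[OF that 1] .
    next
      case 2 show ?thesis using t2[OF 3[OF 2]] .
    next
      case 3 show ?thesis using t2[OF t1[OF \<open>\<And>a b c d. f a \<le> f b \<Longrightarrow> f b \<le> f c \<Longrightarrow> R a b c d\<close>[OF 3 that]]] .
    qed
  qed
  show ?thesis
    using 2[of a b c d] t1[OF 2[of b a c d]] by linarith
qed

text \<open>
  The six conditions say that at most one block is empty.  The blocks appear in the order in which
  they are going to be sorted.
\<close>

definition joinable :: "'v pair_pre_digraph \<Rightarrow> 'a set \<Rightarrow> 'a set \<Rightarrow> 'a set \<Rightarrow> 'a set \<Rightarrow> bool" where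
  "joinable G X N Y Z \<longleftrightarrow>
     (four_parts N X Y Z \<and> X \<union> N \<noteq> {} \<and> X \<union> Y \<noteq> {} \<and> X \<union> Z \<noteq> {} \<and> N \<union> Y \<noteq> {} \<and> N \<union> Z \<noteq> {} \<and> Y \<union> Z \<noteq> {} \<longrightarrow>
      (\<forall>\<phi>. folded_coordinates G (N \<union> X \<union> Y \<union> Z) \<phi> \<longrightarrow>
         card (N \<union> X \<union> Y \<union> Z) \<le> Suc (kappa_set G {\<phi> X, \<phi> Y, \<phi> Z})))"

lemma joinable_swap_XY:
  assumes "joinable G X N Y Z" shows "joinable G Y N X Z"
proof -
  have "N \<union> Y \<union> X \<union> Z = N \<union> X \<union> Y \<union> Z" by blast
  moreover have "{\<phi> Y, \<phi> X, \<phi> Z} = {\<phi> X, \<phi> Y, \<phi> Z}" for \<phi> :: "'b set \<Rightarrow> 'a" by blast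
  moreover have "four_parts N X Y Z" if "four_parts N Y X Z"
    using that unfolding four_parts_def by blast
  ultimately show ?thesis
    using assms unfolding joinable_def by (simp add: Un_commute)
qed

lemma joinable_swap_YZ:
  assumes "joinable G X N Y Z" shows "joinable G X N Z Y"
proof -
  have "N \<union> X \<union> Z \<union> Y = N \<union> X \<union> Y \<union> Z" by blast
  moreover have "{\<phi> X, \<phi> Z, \<phi> Y} = {\<phi> X, \<phi> Y, \<phi> Z}" for \<phi> :: "'b set \<Rightarrow> 'a" by blast
  moreover have "four_parts N X Y Z" if "four_parts N X Z Y"
    using that unfolding four_parts_def by blast
  ultimately show ?thesis
    using assms unfolding joinable_def by (simp add: Un_commute)
qed

text \<open>
  In the coordinates centred at \<open>Y \<union> Z\<close>, the vertex \<open>x\<close> is the complement of \<open>N\<close>, and \<open>y\<close> and \<open>z\<close>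
  have exchanged their roles.
\<close>

lemma joinable_translate:
  assumes "joinable G X N Y Z" shows "joinable G N X Z Y"
  unfolding joinable_def
proof (intro impI allI)
  fix \<phi> :: "'b set \<Rightarrow> 'a"
  let ?I = "N \<union> X \<union> Y \<union> Z"
  assume *: "four_parts X N Z Y \<and> N \<union> X \<noteq> {} \<and> N \<union> Z \<noteq> {} \<and> N \<union> Y \<noteq> {} \<and> X \<union> Z \<noteq> {} \<and> X \<union> Y \<noteq> {} \<and> Z \<union> Y \<noteq> {}"
    and \<phi>: "folded_coordinates G (X \<union> N \<union> Z \<union> Y) \<phi>"
  have I: "X \<union> N \<union> Z \<union> Y = ?I" by blast
  interpret four_parts X N Z Y using * by blast
  have fp: "four_parts N X Y Z" using fin disj by unfold_locales auto
  have \<phi>': "folded_coordinates G ?I \<phi>" using \<phi> unfolding I .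
  have translated: "folded_coordinates G ?I (\<lambda>A. \<phi> (sym_diff A (Y \<union> Z)))"
    by (rule folded_coordinates_translate[OF \<phi>']) blast
  have "X \<union> N \<noteq> {}" "X \<union> Y \<noteq> {}" "X \<union> Z \<noteq> {}" "N \<union> Y \<noteq> {}" "N \<union> Z \<noteq> {}" "Y \<union> Z \<noteq> {}"
    using * by blast+
  with assms fp have all: "\<forall>\<psi>. folded_coordinates G ?I \<psi> \<longrightarrow> card ?I \<le> Suc (kappa_set G {\<psi> X, \<psi> Y, \<psi> Z})"
    unfolding joinable_def by blast
  have "card ?I \<le> Suc (kappa_set G {\<phi> (sym_diff X (Y \<union> Z)), \<phi> (sym_diff Y (Y \<union> Z)), \<phi> (sym_diff Z (Y \<union> Z))})"
    using mp[OF spec[OF all] translated] .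
  moreover have "sym_diff X (Y \<union> Z) = ?I - N" "sym_diff Y (Y \<union> Z) = Z" "sym_diff Z (Y \<union> Z) = Y"
    using disj by auto
  moreover have "\<phi> (?I - N) = \<phi> N" by (rule folded_coordinatesD(2)[OF \<phi>']) blast
  ultimately show "card (X \<union> N \<union> Z \<union> Y) \<le> Suc (kappa_set G {\<phi> N, \<phi> Z, \<phi> Y})"
    unfolding I by (simp only:)
qed

lemma joinable_sorted:
  assumes G: "pair_graph G" and sorted: "card X \<le> card N" "card N \<le> card Y" "card Y \<le> card Z"
  shows "joinable G X N Y Z"
  unfolding joinable_def
proof (intro impI allI, elim conjE)
  fix \<phi> :: "'b set \<Rightarrow> 'a"
  assume "four_parts N X Y Z" and ne: "X \<union> N \<noteq> {}" "X \<union> Z \<noteq> {}" "N \<union> Y \<noteq> {}"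
    and \<phi>: "folded_coordinates G (N \<union> X \<union> Y \<union> Z) \<phi>"
  then interpret four_parts N X Y Z by simp
  have N: "N \<noteq> {}" using ne(1) sorted(1) fin by auto
  have "\<phi> X \<noteq> \<phi> Z"
  proof
    assume "\<phi> X = \<phi> Z"
    then have "Z = X \<or> Z = I - X" by (intro folded_coordinatesD(3)[OF \<phi>]) auto
    then show False using disj N ne(2) by blast
  qed
  then show "card I \<le> Suc (kappa_set G {\<phi> X, \<phi> Y, \<phi> Z})"
    using kappa_set_sorted[OF G \<phi> sorted N] by blast
qed

lemma joinable_all:
  assumes G: "pair_graph G"
  shows "joinable G X N Y Z"
proof (rule sort_four[where f = card and R = "joinable G"])
  have XN: "joinable G b a c d" if "joinable G a b c d" for a b c d :: "'b set"
    using joinable_swap_YZ[OF joinable_translate[OF that]] .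
  then show "joinable G b a c d" if "joinable G a b c d" for a b c d :: "'b set"
    using that .
  show "joinable G a c b d" if "joinable G a b c d" for a b c d :: "'b set"
    using XN[OF joinable_swap_XY[OF XN[OF that]]] .
qed (fact joinable_sorted[OF G] joinable_swap_YZ)+

section \<open>The folded hypercube\<close>

text \<open>
  The subset \<open>A\<close> of \<open>{..n}\<close> flips the digits of the origin \<open>m\<close> in \<open>A\<close>, and all digits once more if
  \<open>n \<in> A\<close>.
\<close>

definition cube_vertex :: "nat \<Rightarrow> bool list \<Rightarrow> nat set \<Rightarrow> bool list" where
  "cube_vertex n m A = map (\<lambda>i. m ! i \<noteq> ((i \<in> A) \<noteq> (n \<in> A))) [0..<n]"

lemma folded_hypercube_simps:
  "pverts (folded_hypercube n) = {x. length x = n}"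
  "(x, y) \<in> parcs (folded_hypercube n) \<longleftrightarrow>
     length x = n \<and> (length y = n \<and> card {i. i < n \<and> x ! i \<noteq> y ! i} = 1 \<or> y = map Not x)"
  by (auto simp: folded_hypercube_def hypercube_def)

lemma folded_coordinates_cube_vertex:
  assumes n: "1 \<le> n"
  shows "folded_coordinates (folded_hypercube n) {..n} (cube_vertex n m)"
proof -
  interpret pair_graph "folded_hypercube n" by (rule pair_graph_folded_hypercube[OF n])
  let ?v = "cube_vertex n m"
  have len: "length (?v A) = n" for A by (simp add: cube_vertex_def)
  have nth: "?v A ! i = (m ! i \<noteq> ((i \<in> A) \<noteq> (n \<in> A)))" if "i < n" for A i
    using that by (simp add: cube_vertex_def)
  have ins: "(?v A, ?v (insert i A)) \<in> parcs (folded_hypercube n)" if i: "i \<le> n" "i \<notin> A" for A i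
  proof (cases "i = n")
    case True
    then have "?v (insert i A) = map Not (?v A)"
      using i by (intro nth_equalityI) (auto simp: len nth)
    then show ?thesis by (simp add: folded_hypercube_simps len)
  next
    case False
    then have "{j. j < n \<and> ?v A ! j \<noteq> ?v (insert i A) ! j} = {i}"
      using i by (auto simp: nth)
    then show ?thesis by (simp add: folded_hypercube_simps len)
  qed
  show ?thesis
    unfolding folded_coordinates_def
  proof (intro conjI allI impI)
    fix A assume A: "A \<subseteq> {..n}"
    show "?v A \<in> pverts (folded_hypercube n)" by (simp add: folded_hypercube_simps len)
    show "?v ({..n} - A) = ?v A" by (intro nth_equalityI) (auto simp: len nth)
    fix B assume B: "B \<subseteq> {..n}"
    show "B = A \<or> B = {..n} - A" if eq: "?v A = ?v B"
    proof -
      have "((i \<in> A) \<noteq> (n \<in> A)) = ((i \<in> B) \<noteq> (n \<in> B))" if "i < n" for i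
        using nth[OF that, of A] nth[OF that, of B] eq by auto
      then have *: "((i \<in> A) \<noteq> (n \<in> A)) = ((i \<in> B) \<noteq> (n \<in> B))" if "i \<le> n" for i
        using that le_neq_implies_less by blast
      show ?thesis
      proof (cases "(n \<in> A) = (n \<in> B)")
        case True
        then have "i \<in> B \<longleftrightarrow> i \<in> A" if "i \<le> n" for i using *[OF that] by blast
        then have "B = A" using A B by auto
        then show ?thesis ..
      next
        case False
        then have "i \<in> B \<longleftrightarrow> i \<notin> A" if "i \<le> n" for i using *[OF that] by blast
        then have "B = {..n} - A" using A B by auto
        then show ?thesis ..
      qed
    qed
    show "(?v A, ?v B) \<in> parcs (folded_hypercube n)" if AB: "(A, B) \<in> flips"
    proof -
      obtain i where "i \<notin> A \<and> B = insert i A \<or> i \<notin> B \<and> A = insert i B"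
        using AB by (auto simp: flips_def)
      then show ?thesis
        using ins[of i A] arcs_symmetric[OF ins[of i B]] A B by auto
    qed
  qed
qed

text \<open>
  With the digitwise majority of \<open>x\<close>, \<open>y\<close>, \<open>z\<close> as origin, the sets of digits in which the three
  vertices differ from the origin are disjoint.  The block \<open>N\<close> always contains the direction \<open>n\<close>, and
  no two of the other blocks are empty since the vertices are distinct.
\<close>

lemma kappa_set_folded_hypercube_ge:
  assumes n: "1 \<le> n" and len: "length x = n" "length y = n" "length z = n"
    and ne: "x \<noteq> y" "x \<noteq> z" "y \<noteq> z"
  shows "n \<le> kappa_set (folded_hypercube n) {x, y, z}"
proof -
  \<comment> \<open>The majority of the three digits.\<close>
  define m where "m = map (\<lambda>i. if x ! i = y ! i then x ! i else z ! i) [0..<n]"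
  define D where "D v = {i. i < n \<and> v ! i \<noteq> m ! i}" for v
  define N where "N = {..n} - D x - D y - D z"
  have m: "m ! i = (if x ! i = y ! i then x ! i else z ! i)" if "i < n" for i
    using that by (simp add: m_def)
  have coord: "cube_vertex n m (D v) = v" if "length v = n" for v
    using that by (intro nth_equalityI) (auto simp: cube_vertex_def D_def)
  have "four_parts N (D x) (D y) (D z)"
    by unfold_locales (auto simp: N_def D_def m split: if_splits)
  moreover have cover: "N \<union> D x \<union> D y \<union> D z = {..n}"
    by (auto simp: N_def D_def)
  moreover have "n \<in> N" by (auto simp: N_def D_def)
  moreover have "D x \<union> D y \<noteq> {}" "D x \<union> D z \<noteq> {}" "D y \<union> D z \<noteq> {}"
    using coord len ne by (metis sup_eq_bot_iff)+
  moreover have "joinable (folded_hypercube n) (D x) N (D y) (D z)"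
    by (rule joinable_all[OF pair_graph_folded_hypercube[OF n]])
  ultimately have "card {..n} \<le> Suc (kappa_set (folded_hypercube n)
      {cube_vertex n m (D x), cube_vertex n m (D y), cube_vertex n m (D z)})"
    using folded_coordinates_cube_vertex[OF n, of m] unfolding joinable_def cover by blast
  then show ?thesis using coord len by simp
qed

lemma degree_folded_hypercube_le: "card {w. (x, w) \<in> parcs (folded_hypercube n)} \<le> Suc n"
proof -
  have "{w. (x, w) \<in> parcs (folded_hypercube n)} \<subseteq> insert (map Not x) ((\<lambda>i. x[i := \<not> x ! i]) ` {..<n})"
  proof
    fix w assume "w \<in> {w. (x, w) \<in> parcs (folded_hypercube n)}"
    then consider "w = map Not x" | "length x = n" "length w = n" "card {i. i < n \<and> x ! i \<noteq> w ! i} = 1"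
      by (auto simp: folded_hypercube_simps)
    then show "w \<in> insert (map Not x) ((\<lambda>i. x[i := \<not> x ! i]) ` {..<n})"
    proof cases
      case 2
      then obtain i where i: "{i. i < n \<and> x ! i \<noteq> w ! i} = {i}" by (auto simp: card_1_singleton_iff)
      then have "i < n" "x ! i \<noteq> w ! i" by blast+
      moreover have "x ! j = w ! j" if "j < n" "j \<noteq> i" for j using i that by blast
      ultimately have "w = x[i := \<not> x ! i]"
        using 2 by (intro nth_equalityI) (auto simp: nth_list_update)
      with \<open>i < n\<close> show ?thesis by blast
    qed simp
  qed
  then have "card {w. (x, w) \<in> parcs (folded_hypercube n)} \<le> card (insert (map Not x) ((\<lambda>i. x[i := \<not> x ! i]) ` {..<n}))"
    by (intro card_mono) auto
  also have "\<dots> \<le> Suc (card ((\<lambda>i. x[i := \<not> x ! i]) ` {..<n}))" by (simp add: card_insert_if)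
  also have "\<dots> \<le> Suc n" using card_image_le[of "{..<n}" "\<lambda>i. x[i := \<not> x ! i]"] by simp
  finally show ?thesis .
qed

theorem theorem1p1:
  fixes n :: nat
  assumes "n \<ge> 2"
  shows "generalized_connectivity 3 (folded_hypercube n) = n"
proof -
  let ?G = "folded_hypercube n"
  have G: "pair_graph ?G" using assms by (intro pair_graph_folded_hypercube) simp
  have "(2::nat) ^ 2 \<le> 2 ^ n" using assms by (intro power_increasing) auto
  then have four: "4 \<le> card (pverts ?G)" by (simp add: card_pverts_folded_hypercube)
  note fin = generalized_connectivity_finite_nonempty[OF card_pverts_folded_hypercube(1), of 3 n]
  have lower: "n \<le> kappa_set ?G S" if S: "S \<subseteq> pverts ?G" "card S = 3" for S
  proof -
    obtain x y z where "S = {x, y, z}" "x \<noteq> y" "x \<noteq> z" "y \<noteq> z"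
      using S(2) by (auto simp: card_3_iff)
    then show ?thesis
      using S(1) assms by (auto simp: folded_hypercube_simps intro!: kappa_set_folded_hypercube_ge)
  qed
  define x where "x = replicate n False"
  define y where "y = map Not x"
  have xy: "x \<in> pverts ?G" "y \<in> pverts ?G" "(x, y) \<in> parcs ?G"
    by (simp_all add: x_def y_def folded_hypercube_simps)
  have "x \<noteq> y"
    using assms by (cases n) (simp_all add: x_def y_def)
  then have "card {x, y} = 2" by simp
  then have "\<not> pverts ?G \<subseteq> {x, y}" using four card_mono[of "{x, y}" "pverts ?G"] by auto
  then obtain z where z: "z \<in> pverts ?G" "z \<noteq> x" "z \<noteq> y" by blast
  let ?S = "{x, y, z}"
  have S: "?S \<subseteq> pverts ?G" "card ?S = 3" using xy z \<open>x \<noteq> y\<close> by auto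
  have "kappa_set ?G ?S \<le> n"
    by (rule kappa_set_le_degree[OF G xy(3) S(1)]) (use z degree_folded_hypercube_le in auto)
  with lower[OF S] have "kappa_set ?G ?S = n" by simp
  show ?thesis
    unfolding generalized_connectivity_def
  proof (rule Min_eqI)
    show "finite {kappa_set ?G S |S. S \<subseteq> pverts ?G \<and> card S = 3}" using fin(1) four by simp
    show "n \<le> k" if k: "k \<in> {kappa_set ?G S |S. S \<subseteq> pverts ?G \<and> card S = 3}" for k
    proof -
      obtain S where "S \<subseteq> pverts ?G" "card S = 3" "k = kappa_set ?G S" using k by blast
      then show ?thesis using lower[of S] by simp
    qed
    show "n \<in> {kappa_set ?G S |S. S \<subseteq> pverts ?G \<and> card S = 3}"
      using S \<open>kappa_set ?G ?S = n\<close> by (intro CollectI exI[of _ ?S]) simp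
  qed
qed

end
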